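(* For every integer $n$ let $b_n=|B_n|-\tfrac12|\partial B_n|$, and let $\mu_n$ be the limit sand distribution of the divisible sandpile on the Sierpinski gasket graph $\mathsf{SG}$ with height function $h\equiv1$ and initial mass distribution $b_n\delta_{(0,0)}$. Then $$\mu_n(z)=\begin{cases}1 & \text{if } z\in B_n\setminus\partial B_n,\\ 1/2 & \text{if } z\in\partial B_n,\\ 0 & \text{if } z\notin B_n,\end{cases}$$ and the corresponding sandpile cluster is $B_{n-1}$.
   Context: **Sierpinski gasket graph.** Let $G_0$ be the complete graph on the vertex set $\{(0,0),(1,0),(0,1)\}\subset\mathbb{Z}^2$. Recursively, $G_{k+1}$ is the union (of vertices and edges) of the three translates of $G_k$ by $(0,0)$, $(2^k,0)$ and $(0,2^k)$. Put $\mathsf{SG}^+=\bigcup_{k\ge0}G_k$, $\mathsf{SG}^-=-\mathsf{SG}^+$ (the image under $z\mapsto -z$), and $\mathsf{SG}=\mathsf{SG}^+\cup\mathsf{SG}^-$. This is an infinite 4-regular graph whose vertices are points of $\mathbb{Z}^2$; $\sim$ denotes adjacency and $o=(0,0)$. The ball of radius $n$ around $o$ in the graph metric is $B_n=\{(x,y)\in\mathsf{SG}:|x|+|y|\le n\}$ (empty for $n<0$). Its inner boundary is $\partial B_n=\{u\in B_n:\exists v\in\mathsf{SG}\setminus B_n,\ u\sim v\}$. **Divisible sandpile.** For $f:\mathsf{SG}\to\mathbb{R}$ let $\Delta f(x)=\frac14\sum_{y\sim x}f(y)-f(x)$. Let $h\equiv1$ be the height function and let $\mu_0:\mathsf{SG}\to\mathbb{R}_{\ge0}$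 be a finitely supported initial sand distribution. The toppling operator is $T_x\mu=\mu+\max\{\mu(x)-h(x),0\}\,\Delta\delta_x$, where $\delta_x$ is the indicator function of $\{x\}$. Given a sequence $(x_k)_{k\ge1}$ of vertices containing every vertex infinitely often (a toppling sequence), the sand distribution after $k$ steps is $T_{x_k}\cdots T_{x_1}\mu_0$, and the odometer after $k$ steps assigns to $y$ the total mass emitted from $y$ during the first $k$ topplings. As $k\to\infty$, the odometers increase pointwise to a finite limit $u$ (the odometer function), and the sand distributions converge pointwise to a limit $\mu=\mu_0+\Delta u$ (the limit sand distribution); both limits do not depend on the toppling sequence. The sandpile cluster is $\{z\in\mathsf{SG}:u(z)>0\}$. *)

theory Defs
  imports Complex_Main "HOL-Library.Product_Plus" "HOL-Library.Countable_Set"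
    "HOL-Library.Indicator_Function"
begin

section \<open>The Sierpinski gasket graph\<close>

text \<open>Vertices are points of the integer lattice; edge sets are symmetric irreflexive relations.\<close>

type_synonym point = "int \<times> int"

definition shifts :: "nat \<Rightarrow> point set" where
  "shifts k = {(0, 0), (2 ^ k, 0), (0, 2 ^ k)}"

primrec G_verts :: "nat \<Rightarrow> point set" where
  "G_verts 0 = {(0, 0), (1, 0), (0, 1)}"
| "G_verts (Suc k) = (\<Union>t\<in>shifts k. (+) t ` G_verts k)"

primrec G_edges :: "nat \<Rightarrow> point rel" where
  "G_edges 0 = {(u, v). u \<in> G_verts 0 \<and> v \<in> G_verts 0 \<and> u \<noteq> v}"
| "G_edges (Suc k) = (\<Union>t\<in>shifts k. map_prod ((+) t) ((+) t) ` G_edges k)"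

definition SG_plus :: "point set" where
  "SG_plus = (\<Union>k. G_verts k)"

definition SG_plus_edges :: "point rel" where
  "SG_plus_edges = (\<Union>k. G_edges k)"

definition SG :: "point set" where
  "SG = SG_plus \<union> uminus ` SG_plus"

definition SG_edges :: "point rel" where
  "SG_edges = SG_plus_edges \<union> map_prod uminus uminus ` SG_plus_edges"

definition neighbours :: "point \<Rightarrow> point set" where
  "neighbours x = {y. (x, y) \<in> SG_edges}"

text \<open>The radius is an integer, so that the ball is empty for negative radius. That this is the
  ball of the graph metric is lemma \<open>SG_ball_eq_graph_ball\<close> below.\<close>

definition SG_ball :: "int \<Rightarrow> point set" where
  "SG_ball n = {(x, y) \<in> SG. \<bar>x\<bar> + \<bar>y\<bar> \<le> n}"

definition inner_boundary :: "point set \<Rightarrow> point set" where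
  "inner_boundary A = {u \<in> A. \<exists>v \<in> SG - A. (u, v) \<in> SG_edges}"


section \<open>The divisible sandpile\<close>

text \<open>Functions on the vertex set are rendered as functions on all lattice points; only their
  values on \<^const>\<open>SG\<close> carry meaning.\<close>

definition laplacian :: "(point \<Rightarrow> real) \<Rightarrow> point \<Rightarrow> real" where
  "laplacian f x = 1 / 4 * (\<Sum>y\<in>neighbours x. f y) - f x"

text \<open>The mass emitted from \<open>x\<close> when \<open>x\<close> is toppled, for the height function \<open>h\<close>.\<close>

definition emitted :: "(point \<Rightarrow> real) \<Rightarrow> point \<Rightarrow> (point \<Rightarrow> real) \<Rightarrow> real" where
  "emitted h x \<mu> = max (\<mu> x - h x) 0"

definition topple :: "(point \<Rightarrow> real) \<Rightarrow> point \<Rightarrow> (point \<Rightarrow> real) \<Rightarrow> point \<Rightarrow> real" where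
  "topple h x \<mu> = (\<lambda>y. \<mu> y + emitted h x \<mu> * laplacian (indicat_real {x}) y)"

text \<open>Toppling sequences are indexed from 0: step \<open>k + 1\<close> topples the vertex \<open>s k\<close>.\<close>

definition toppling_sequence :: "(nat \<Rightarrow> point) \<Rightarrow> bool" where
  "toppling_sequence s \<longleftrightarrow> range s \<subseteq> SG \<and> (\<forall>x\<in>SG. infinite {k. s k = x})"

primrec sand_after ::
  "(point \<Rightarrow> real) \<Rightarrow> (point \<Rightarrow> real) \<Rightarrow> (nat \<Rightarrow> point) \<Rightarrow> nat \<Rightarrow> point \<Rightarrow> real" where
  "sand_after h \<mu>0 s 0 = \<mu>0"
| "sand_after h \<mu>0 s (Suc k) = topple h (s k) (sand_after h \<mu>0 s k)"

definition odometer_after ::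
  "(point \<Rightarrow> real) \<Rightarrow> (point \<Rightarrow> real) \<Rightarrow> (nat \<Rightarrow> point) \<Rightarrow> nat \<Rightarrow> point \<Rightarrow> real" where
  "odometer_after h \<mu>0 s k y =
     (\<Sum>j | j < k \<and> s j = y. emitted h y (sand_after h \<mu>0 s j))"

text \<open>The following limits are meaningful only together with convergence of the sequences
  concerned, since \<^const>\<open>lim\<close> is unspecified otherwise.\<close>

definition odometer ::
  "(point \<Rightarrow> real) \<Rightarrow> (point \<Rightarrow> real) \<Rightarrow> (nat \<Rightarrow> point) \<Rightarrow> point \<Rightarrow> real" where
  "odometer h \<mu>0 s z = lim (\<lambda>k. odometer_after h \<mu>0 s k z)"

definition limit_sand ::
  "(point \<Rightarrow> real) \<Rightarrow> (point \<Rightarrow> real) \<Rightarrow> (nat \<Rightarrow> point) \<Rightarrow> point \<Rightarrow> real" where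
  "limit_sand h \<mu>0 s z = lim (\<lambda>k. sand_after h \<mu>0 s k z)"

definition sandpile_cluster ::
  "(point \<Rightarrow> real) \<Rightarrow> (point \<Rightarrow> real) \<Rightarrow> (nat \<Rightarrow> point) \<Rightarrow> point set" where
  "sandpile_cluster h \<mu>0 s = {z \<in> SG. odometer h \<mu>0 s z > 0}"

definition ball_mass :: "int \<Rightarrow> real" where
  "ball_mass n = real (card (SG_ball n)) - 1 / 2 * real (card (inner_boundary (SG_ball n)))"


section \<open>Consistency of the definitions\<close>

lemma finite_SG_ball: "finite (SG_ball n)"
proof (rule finite_subset)
  show "SG_ball n \<subseteq> {-n..n} \<times> {-n..n}"
    by (auto simp: SG_ball_def)
qed simp

lemma SG_ball_negative: "n < 0 \<Longrightarrow> SG_ball n = {}"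
  by (auto simp: SG_ball_def)

lemma G_verts_shift: "t \<in> shifts k \<Longrightarrow> w \<in> G_verts k \<Longrightarrow> t + w \<in> G_verts (Suc k)"
  by auto

lemma origin_in_G_verts: "(0, 0) \<in> G_verts k"
proof (induction k)
  case (Suc k)
  show ?case using G_verts_shift[of "(0, 0)" k, OF _ Suc] by (simp add: shifts_def)
qed simp

lemma origin_in_SG: "(0, 0) \<in> SG"
  using origin_in_G_verts by (auto simp: SG_def SG_plus_def)

lemma ex_toppling_sequence: "\<exists>s. toppling_sequence s"
proof -
  define s where "s k = from_nat_into SG (fst (prod_decode k))" for k
  have ne: "SG \<noteq> {}" using origin_in_SG by auto
  have "infinite {k. s k = x}" if x: "x \<in> SG" for x
  proof -
    obtain i where i: "from_nat_into SG i = x"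
      using from_nat_into_surj[OF countableI_type x] by blast
    have "range (\<lambda>j. prod_encode (i, j)) \<subseteq> {k. s k = x}"
      by (auto simp: s_def i)
    moreover have "infinite (range (\<lambda>j. prod_encode (i, j)))"
      by (rule range_inj_infinite) (auto simp: inj_on_def)
    ultimately show ?thesis using finite_subset by blast
  qed
  moreover have "range s \<subseteq> SG"
    using from_nat_into[OF ne] by (auto simp: s_def)
  ultimately show ?thesis
    unfolding toppling_sequence_def by blast
qed

lemma G_edges_bounds:
  assumes "(u, v) \<in> G_edges k"
  shows "u \<in> G_verts k \<and> v \<in> G_verts k \<and> u \<noteq> v \<and> (v, u) \<in> G_edges k \<and>
    0 \<le> fst u \<and> 0 \<le> snd u \<and> 0 \<le> fst v \<and> 0 \<le> snd v \<and>
    \<bar>fst v - fst u\<bar> \<le> 1 \<and> \<bar>snd v - snd u\<bar> \<le> 1 \<and> \<bar>fst v + snd v - fst u - snd u\<bar> \<le> 1"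
  using assms
proof (induction k arbitrary: u v)
  case 0
  then show ?case by auto
next
  case (Suc k)
  then obtain t a b where t: "t \<in> shifts k" and ab: "(a, b) \<in> G_edges k"
    and uv: "u = t + a" "v = t + b" by auto
  have t0: "0 \<le> fst t" "0 \<le> snd t" using t by (auto simp: shifts_def)
  have vs: "(v, u) \<in> G_edges (Suc k)"
    using t uv Suc.IH[OF ab] by (force simp: image_iff)
  show ?case
    using Suc.IH[OF ab] t t0 vs uv by auto
qed

lemma SG_edges_bounds:
  assumes "(u, v) \<in> SG_edges"
  shows "u \<in> SG" "v \<in> SG" "u \<noteq> v" "(v, u) \<in> SG_edges"
    "\<bar>fst v - fst u\<bar> \<le> 1" "\<bar>snd v - snd u\<bar> \<le> 1"
    "\<bar>fst v\<bar> + \<bar>snd v\<bar> \<le> \<bar>fst u\<bar> + \<bar>snd u\<bar> + 1"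
proof -
  have "\<exists>k. (u, v) \<in> G_edges k \<or> (- u, - v) \<in> G_edges k"
    using assms by (auto simp: SG_edges_def SG_plus_edges_def)
  then obtain k where "(u, v) \<in> G_edges k \<or> (- u, - v) \<in> G_edges k" ..
  then have "u \<in> SG \<and> v \<in> SG \<and> u \<noteq> v \<and> (v, u) \<in> SG_edges \<and>
    \<bar>fst v - fst u\<bar> \<le> 1 \<and> \<bar>snd v - snd u\<bar> \<le> 1 \<and>
    \<bar>fst v\<bar> + \<bar>snd v\<bar> \<le> \<bar>fst u\<bar> + \<bar>snd u\<bar> + 1"
  proof
    assume "(u, v) \<in> G_edges k"
    from G_edges_bounds[OF this] show ?thesis
      by (auto simp: SG_def SG_plus_def SG_edges_def SG_plus_edges_def)
  next
    assume "(- u, - v) \<in> G_edges k"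
    note b = G_edges_bounds[OF this]
    have "map_prod uminus uminus (- v, - u) \<in> SG_edges"
      using b unfolding SG_edges_def SG_plus_edges_def by blast
    moreover have "- (- u) \<in> SG" "- (- v) \<in> SG"
      using b unfolding SG_def SG_plus_def by blast+
    ultimately show ?thesis using b by auto
  qed
  then show "u \<in> SG" "v \<in> SG" "u \<noteq> v" "(v, u) \<in> SG_edges"
    "\<bar>fst v - fst u\<bar> \<le> 1" "\<bar>snd v - snd u\<bar> \<le> 1"
    "\<bar>fst v\<bar> + \<bar>snd v\<bar> \<le> \<bar>fst u\<bar> + \<bar>snd u\<bar> + 1" by auto
qed

lemma finite_neighbours: "finite (neighbours x)"
proof (rule finite_subset)
  show "neighbours x \<subseteq> {fst x - 1..fst x + 1} \<times> {snd x - 1..snd x + 1}"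
    using SG_edges_bounds(5,6)[of x] by (fastforce simp: neighbours_def abs_le_iff)
qed simp

lemma corners_in_G_verts: "(2 ^ k, 0) \<in> G_verts k" "(0, 2 ^ k) \<in> G_verts k"
proof (induction k)
  case (Suc k)
  case 1
  have "(2 ^ k, 0) + (2 ^ k, 0) \<in> G_verts (Suc k)"
    by (rule G_verts_shift) (use Suc in \<open>auto simp: shifts_def\<close>)
  then show ?case by (simp del: G_verts.simps)
next
  case (Suc k)
  case 2
  have "(0, 2 ^ k) + (0, 2 ^ k) \<in> G_verts (Suc k)"
    by (rule G_verts_shift) (use Suc in \<open>auto simp: shifts_def\<close>)
  then show ?case by (simp del: G_verts.simps)
qed simp_all

lemma G_edges_mono: "(u, v) \<in> G_edges k \<Longrightarrow> (u, v) \<in> G_edges (Suc k)"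
  by (auto simp: shifts_def zero_prod_def[symmetric] map_prod_def image_iff)

lemma G_descent:
  assumes "v \<in> G_verts k" "v \<noteq> (0, 0)"
  shows "\<exists>u. (u, v) \<in> G_edges k \<and> fst u + snd u = fst v + snd v - 1"
  using assms
proof (induction k arbitrary: v)
  case 0
  then show ?case by (intro exI[of _ "(0, 0)"]) auto
next
  case (Suc k)
  from Suc.prems obtain t w where t: "t \<in> shifts k" and w: "w \<in> G_verts k" and v: "v = t + w"
    by auto
  show ?case
  proof (cases "w = (0, 0)")
    case True
    then have "v \<in> G_verts k"
      using t v corners_in_G_verts[of k] w by (auto simp: shifts_def)
    from Suc.IH[OF this Suc.prems(2)] show ?thesis using G_edges_mono by blast
  next
    case False
    from Suc.IH[OF w this] obtain u where u: "(u, w) \<in> G_edges k"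
      "fst u + snd u = fst w + snd w - 1" by blast
    have "(t + u, v) \<in> G_edges (Suc k)" using t u(1) v by force
    moreover have "fst (t + u) + snd (t + u) = fst v + snd v - 1" using u v by simp
    ultimately show ?thesis by blast
  qed
qed

lemma SG_descent:
  assumes "v \<in> SG" "v \<noteq> (0, 0)"
  shows "\<exists>u. (u, v) \<in> SG_edges \<and> \<bar>fst u\<bar> + \<bar>snd u\<bar> = \<bar>fst v\<bar> + \<bar>snd v\<bar> - 1"
proof -
  have "\<exists>k. v \<in> G_verts k \<or> - v \<in> G_verts k"
    using assms(1) by (auto simp: SG_def SG_plus_def)
  then obtain k where "v \<in> G_verts k \<or> - v \<in> G_verts k" ..
  then show ?thesis
  proof
    assume "v \<in> G_verts k"
    from G_descent[OF this assms(2)] obtain u where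
      u: "(u, v) \<in> G_edges k" "fst u + snd u = fst v + snd v - 1" by blast
    then show ?thesis using G_edges_bounds[OF u(1)]
      by (intro exI[of _ u]) (auto simp: SG_edges_def SG_plus_edges_def)
  next
    assume v: "- v \<in> G_verts k"
    have "- v \<noteq> (0, 0)" using assms(2) by (cases v) auto
    from G_descent[OF v this] obtain u where
      u: "(u, - v) \<in> G_edges k" "fst u + snd u = fst (- v) + snd (- v) - 1" by blast
    have "(- u, - (- v)) \<in> SG_edges"
      using u(1) unfolding SG_edges_def SG_plus_edges_def by force
    then show ?thesis using G_edges_bounds[OF u(1)] u(2)
      by (intro exI[of _ "- u"]) auto
  qed
qed

lemma SG_ball_eq_graph_ball:
  "SG_ball (int n) = {z. \<exists>m\<le>n. ((0, 0), z) \<in> SG_edges ^^ m}"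
proof -
  have "z \<in> SG \<and> \<bar>fst z\<bar> + \<bar>snd z\<bar> \<le> int m" if "((0, 0), z) \<in> SG_edges ^^ m" for z m
    using that
  proof (induction m arbitrary: z)
    case 0
    then show ?case using origin_in_SG by auto
  next
    case (Suc m)
    then obtain y where "((0, 0), y) \<in> SG_edges ^^ m" "(y, z) \<in> SG_edges" by auto
    then show ?case using Suc.IH[of y] SG_edges_bounds[of y z] by auto
  qed
  moreover have "((0, 0), z) \<in> SG_edges ^^ m"
    if "z \<in> SG" "\<bar>fst z\<bar> + \<bar>snd z\<bar> = int m" for z m
    using that
  proof (induction m arbitrary: z)
    case 0
    then show ?case by (cases z) auto
  next
    case (Suc m)
    then have "z \<noteq> (0, 0)" by auto
    from SG_descent[OF Suc.prems(1) this] obtain y where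
      y: "(y, z) \<in> SG_edges" "\<bar>fst y\<bar> + \<bar>snd y\<bar> = int m" using Suc.prems(2) by auto
    then have "((0, 0), y) \<in> SG_edges ^^ m" using Suc.IH SG_edges_bounds(1) by blast
    then show ?case using y(1) by auto
  qed
  moreover have "\<exists>m\<le>n. \<bar>x\<bar> + \<bar>y\<bar> = int m" if "\<bar>x\<bar> + \<bar>y\<bar> \<le> int n" for x y :: int
    using that by (intro exI[of _ "nat (\<bar>x\<bar> + \<bar>y\<bar>)"]) auto
  ultimately show ?thesis
    unfolding SG_ball_def by fastforce
qed

end

theory Submission
  imports Defs
begin

text \<open>The limit is identified by exhibiting the odometer. A function \<open>w \<ge> 0\<close> that is positive exactly on
the ball of radius \<open>n - 1\<close> and whose Laplacian turns the initial mass into the claimed distribution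
must be the odometer: by the least action principle it bounds all odometers, and the difference to
their limit is subharmonic on that ball and zero outside, hence zero by the maximum principle
(\<open>sandpile_limits\<close>).

To find \<open>w\<close>, one splits the gasket into its triangular cells. Each vertex lies in exactly two of
them, and away from the origin the claimed density of a vertex is half the number of cells of the
ball that contain it (\<open>ball_density_eq_cell_count\<close>). Likewise the Laplacian is a sum of
contributions of cells (\<open>laplacian_eq_flux\<close>). So the problem decomposes like the set of cells, which,
on each half of the gasket, is a disjoint union of translates at every scale. For
\<open>2 ^ k < n \<le> 2 ^ (k + 1)\<close> the half ball of radius \<open>n\<close> consists of \<open>G_k\<close> and two translated half
balls of radius \<open>n - 2 ^ k\<close> at the far corners of \<open>G_k\<close>. The odometer on it is glued from those of
the half balls of radius \<open>2 ^ k\<close> and \<open>n - 2 ^ k\<close>, with a harmonic function and a constant added on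
\<open>G_k\<close> in order to feed the two copies (\<open>odometer_on_G_verts\<close>). The harmonic functions come from the
classical one-fifth--two-fifths rule (\<open>harmonic_extension\<close>). The mass at the origin need not be
computed along the way: since the Laplacian of a finitely supported function has sum zero, it is the
total mass \<open>b_n\<close> of the target (\<open>ball_odometer\<close>).\<close>

section \<open>Cells of the gasket\<close>

definition level :: "point \<Rightarrow> int" where
  "level z = fst z + snd z"

definition tri :: "point \<Rightarrow> point set" where
  "tri p = {p, p + (1, 0), p + (0, 1)}"

text \<open>A triangle \<open>tri p\<close> is addressed by its corner \<open>p\<close> nearest to the origin. These are the addresses
of the three upward lattice triangles with corner \<open>x\<close>, whether or not they are cells of the gasket.\<close>

definition bases_at :: "point \<Rightarrow> point set" where
  "bases_at x = {x, x - (1, 0), x - (0, 1)}"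

primrec G_bases :: "nat \<Rightarrow> point set" where
  "G_bases 0 = {(0, 0)}"
| "G_bases (Suc k) = (\<Union>t\<in>shifts k. (+) t ` G_bases k)"

definition SG_bases :: "point set" where
  "SG_bases = (\<Union>k. G_bases k)"

definition tri_sum :: "(point \<Rightarrow> real) \<Rightarrow> point \<Rightarrow> real" where
  "tri_sum f p = f p + f (p + (1, 0)) + f (p + (0, 1))"

text \<open>The part of the Laplacian at \<open>x\<close> that comes from the cells addressed by \<open>C\<close>: a cell contributes
a quarter of the two differences along its edges at \<open>x\<close>. When \<open>x\<close> lies in exactly two cells, its
four neighbours are covered and the flux is the full Laplacian. Unlike the Laplacian it is
additive over any decomposition of the set of cells.\<close>

definition flux :: "point set \<Rightarrow> (point \<Rightarrow> real) \<Rightarrow> point \<Rightarrow> real" where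
  "flux C f x = (\<Sum>p\<in>bases_at x. of_bool (p \<in> C) * ((tri_sum f p - 3 * f x) / 4))"

definition cell_count :: "point set \<Rightarrow> point \<Rightarrow> real" where
  "cell_count C x = (\<Sum>p\<in>bases_at x. of_bool (p \<in> C))"

definition below :: "point set \<Rightarrow> int \<Rightarrow> point set" where
  "below C n = {p \<in> C. level p < n}"

lemma bases_at_iff: "p \<in> bases_at x \<longleftrightarrow> x \<in> tri p"
  by (cases x, cases p) (auto simp: bases_at_def tri_def)

lemma finite_bases_at [simp]: "finite (bases_at x)"
  by (simp add: bases_at_def)

lemma sum_bases_at:
  fixes g :: "point \<Rightarrow> real"
  shows "(\<Sum>p\<in>bases_at x. g p) = g x + g (x - (1, 0)) + g (x - (0, 1))"
  by (cases x) (simp add: bases_at_def)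

lemma level_tri: "z \<in> tri p \<Longrightarrow> level p \<le> level z \<and> level z \<le> level p + 1"
  by (auto simp: tri_def level_def)

lemma level_add [simp]: "level (a + b) = level a + level b"
  by (simp add: level_def)

lemma tri_translate: "tri (t + p) = (+) t ` tri p"
  by (auto simp: tri_def add.assoc)

lemma G_verts_eq_cells: "G_verts k = (\<Union>p\<in>G_bases k. tri p)"
proof (induction k)
  case 0
  show ?case by (auto simp: tri_def)
next
  case (Suc k)
  show ?case by (auto simp: Suc tri_translate)
qed

lemma G_edges_eq_cells:
  "G_edges k = {(u, v). u \<noteq> v \<and> (\<exists>p\<in>G_bases k. u \<in> tri p \<and> v \<in> tri p)}"
proof (induction k)
  case 0
  show ?case by (auto simp: tri_def)
next
  case (Suc k)
  show ?case
    unfolding G_edges.simps G_bases.simps Suc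
    by (force simp: tri_translate image_iff)
qed

lemma G_bases_bounds:
  assumes "p \<in> G_bases k"
  shows "0 \<le> fst p \<and> 0 \<le> snd p \<and> level p < 2 ^ k"
  using assms
proof (induction k arbitrary: p)
  case 0
  then show ?case by (simp add: level_def)
next
  case (Suc k)
  then obtain t q where "t \<in> shifts k" "q \<in> G_bases k" "p = t + q" by auto
  then show ?case using Suc.IH[of q] by (auto simp: shifts_def level_def)
qed

lemma G_verts_bounds:
  assumes "z \<in> G_verts k"
  shows "0 \<le> fst z \<and> 0 \<le> snd z \<and> level z \<le> 2 ^ k"
  using assms G_bases_bounds[of _ k]
  by (fastforce simp: G_verts_eq_cells tri_def level_def)

lemma sum_shifts:
  fixes g :: "point \<Rightarrow> real"
  shows "(\<Sum>t\<in>shifts k. g t) = g (0, 0) + g (2 ^ k, 0) + g (0, 2 ^ k)"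
  by (simp add: shifts_def)

lemma mem_translate_iff: "x \<in> (+) t ` A \<longleftrightarrow> x - t \<in> A" for x t :: point
  by (auto simp: image_iff algebra_simps intro: bexI[of _ "x - t"])

text \<open>The three translates of \<open>G_bases k\<close> are disjoint, although those of \<open>G_verts k\<close> share corners.
This is the reason for counting cells instead of vertices.\<close>

lemma below_Suc_indicator:
  "(of_bool (p \<in> below (G_bases (Suc k)) n) :: real)
     = of_bool (p \<in> below (G_bases k) n)
       + of_bool (p - (2 ^ k, 0) \<in> below (G_bases k) (n - 2 ^ k))
       + of_bool (p - (0, 2 ^ k) \<in> below (G_bases k) (n - 2 ^ k))"
proof -
  have m: "p \<in> G_bases (Suc k) \<longleftrightarrow>
    p \<in> G_bases k \<or> p - (2 ^ k, 0) \<in> G_bases k \<or> p - (0, 2 ^ k) \<in> G_bases k"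
    by (cases p) (simp add: shifts_def mem_translate_iff)
  show ?thesis
    using G_bases_bounds[of p k] G_bases_bounds[of "p - (2 ^ k, 0)" k]
      G_bases_bounds[of "p - (0, 2 ^ k)" k]
    unfolding below_def mem_Collect_eq m by (auto simp: level_def)
qed

lemma below_all: "n \<ge> 2 ^ k \<Longrightarrow> below (G_bases k) n = G_bases k"
  using G_bases_bounds by (fastforce simp: below_def)

lemma below_none: "n \<le> 0 \<Longrightarrow> below (G_bases k) n = {}"
  using G_bases_bounds[of _ k] by (fastforce simp: below_def level_def)

lemma G_bases_Suc_indicator:
  "(of_bool (p \<in> G_bases (Suc k)) :: real) = (\<Sum>t\<in>shifts k. of_bool (p - t \<in> G_bases k))"
  using below_Suc_indicator[of p k "2 ^ (k + 1)"]
  by (simp add: below_all sum_shifts del: G_bases.simps) (cases p, simp)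

lemma flux_Suc:
  "flux (G_bases (Suc k)) f x = (\<Sum>t\<in>shifts k. flux (G_bases k) (\<lambda>z. f (t + z)) (x - t))"
proof -
  have "flux (G_bases k) (\<lambda>z. f (t + z)) (x - t)
      = (\<Sum>p\<in>bases_at x. of_bool (p - t \<in> G_bases k) * ((tri_sum f p - 3 * f x) / 4))" for t
    unfolding flux_def sum_bases_at tri_sum_def
    by (simp add: algebra_simps)
  then have "(\<Sum>t\<in>shifts k. flux (G_bases k) (\<lambda>z. f (t + z)) (x - t))
    = (\<Sum>t\<in>shifts k. \<Sum>p\<in>bases_at x. of_bool (p - t \<in> G_bases k) * ((tri_sum f p - 3 * f x) / 4))"
    by simp
  also have "\<dots> = (\<Sum>p\<in>bases_at x. \<Sum>t\<in>shifts k. of_bool (p - t \<in> G_bases k) * ((tri_sum f p - 3 * f x) / 4))"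
    by (rule sum.swap)
  also have "\<dots> = flux (G_bases (Suc k)) f x"
    unfolding flux_def G_bases_Suc_indicator sum_distrib_right ..
  finally show ?thesis ..
qed

lemma cell_count_below_Suc:
  "cell_count (below (G_bases (Suc k)) n) x
     = cell_count (below (G_bases k) n) x
       + cell_count (below (G_bases k) (n - 2 ^ k)) (x - (2 ^ k, 0))
       + cell_count (below (G_bases k) (n - 2 ^ k)) (x - (0, 2 ^ k))"
  unfolding cell_count_def below_Suc_indicator sum_bases_at
  by (simp add: algebra_simps)

lemma flux_cong:
  assumes "\<And>p z. p \<in> C \<Longrightarrow> z \<in> tri p \<Longrightarrow> f z = g z"
  shows "flux C f x = flux C g x"
  unfolding flux_def
proof (rule sum.cong)
  fix p assume "p \<in> bases_at x"
  then have "x \<in> tri p" by (simp add: bases_at_iff)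
  then show "of_bool (p \<in> C) * ((tri_sum f p - 3 * f x) / 4)
      = of_bool (p \<in> C) * ((tri_sum g p - 3 * g x) / 4)"
    using assms[of p] by (cases "p \<in> C") (simp_all add: tri_sum_def tri_def)
qed simp

lemma flux_affine:
  "flux C (\<lambda>z. f z + b * g z + c) x = flux C f x + b * flux C g x"
  by (simp add: flux_def sum_bases_at tri_sum_def algebra_simps add_divide_distrib diff_divide_distrib)

lemma flux_zero [simp]: "flux C (\<lambda>_. 0) x = 0"
  by (simp add: flux_def tri_sum_def)

text \<open>Functions on the three copies of \<open>G_k\<close> combine to one on \<open>G_(k+1)\<close> as soon as they agree at
the three points where two copies meet; the fluxes then just add up.\<close>

lemma glue:
  fixes f0 f1 f2 :: "point \<Rightarrow> real"
  assumes "f0 (2 ^ k, 0) = f1 (0, 0)" "f0 (0, 2 ^ k) = f2 (0, 0)"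
    "f1 (0, 2 ^ k) = f2 (2 ^ k, 0)"
  obtains f where "\<And>z. z \<in> G_verts k \<Longrightarrow> f z = f0 z"
    "\<And>z. z \<in> G_verts k \<Longrightarrow> f ((2 ^ k, 0) + z) = f1 z"
    "\<And>z. z \<in> G_verts k \<Longrightarrow> f ((0, 2 ^ k) + z) = f2 z"
    "\<And>x. flux (G_bases (Suc k)) f x = flux (G_bases k) f0 x
       + flux (G_bases k) f1 (x - (2 ^ k, 0)) + flux (G_bases k) f2 (x - (0, 2 ^ k))"
proof -
  define f where "f x = (if x \<in> G_verts k then f0 x
    else if x - (2 ^ k, 0) \<in> G_verts k then f1 (x - (2 ^ k, 0)) else f2 (x - (0, 2 ^ k)))" for x
  have e0: "f z = f0 z" if "z \<in> G_verts k" for z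
    using that by (simp add: f_def)
  have e1: "f ((2 ^ k, 0) + z) = f1 z" if z: "z \<in> G_verts k" for z
  proof (cases "(2 ^ k, 0) + z \<in> G_verts k")
    case True
    then have "z = (0, 0)"
      using G_verts_bounds[OF z] G_verts_bounds[OF True] by (cases z) (auto simp: level_def)
    then show ?thesis using True assms(1) by (simp add: f_def)
  next
    case False
    then show ?thesis using z by (simp add: f_def)
  qed
  have e2: "f ((0, 2 ^ k) + z) = f2 z" if z: "z \<in> G_verts k" for z
  proof (cases "(0, 2 ^ k) + z \<in> G_verts k")
    case True
    then have "z = (0, 0)"
      using G_verts_bounds[OF z] G_verts_bounds[OF True] by (cases z) (auto simp: level_def)
    then show ?thesis using True assms(2) by (simp add: f_def)
  next
    case F: False
    show ?thesis
    proof (cases "(0, 2 ^ k) + z - (2 ^ k, 0) \<in> G_verts k")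
      case True
      then have "z = (2 ^ k, 0)"
        using G_verts_bounds[OF z] G_verts_bounds[OF True] by (cases z) (auto simp: level_def)
      then show ?thesis using True F assms(3) by (simp add: f_def)
    next
      case False
      then show ?thesis using F by (simp add: f_def)
    qed
  qed
  have sub: "tri p \<subseteq> G_verts k" if "p \<in> G_bases k" for p
    using that by (auto simp: G_verts_eq_cells)
  have "flux (G_bases k) f x = flux (G_bases k) f0 x"
    "flux (G_bases k) (\<lambda>z. f ((2 ^ k, 0) + z)) x = flux (G_bases k) f1 x"
    "flux (G_bases k) (\<lambda>z. f ((0, 2 ^ k) + z)) x = flux (G_bases k) f2 x" for x
    using sub by (auto intro!: flux_cong e0 e1 e2)
  then have "flux (G_bases (Suc k)) f x = flux (G_bases k) f0 x
       + flux (G_bases k) f1 (x - (2 ^ k, 0)) + flux (G_bases k) f2 (x - (0, 2 ^ k))" for x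
    unfolding flux_Suc sum_shifts by (cases x) (simp add: zero_prod_def[symmetric])
  with e0 e1 e2 show thesis by (rule that)
qed

section \<open>Harmonic functions on finite gaskets\<close>

text \<open>The harmonic functions with prescribed corner values. The inner corners of \<open>G_(k+1)\<close> receive
the values of the one-fifth--two-fifths rule, for which the fluxes of two adjacent copies cancel;
the fluxes at the outer corners shrink by the factor \<open>3 / 5\<close> in each step. Writing the flux as a
combination of corner indicators valid at every lattice point makes the gluing step a computation.\<close>

lemma harmonic_extension:
  "\<exists>f. f (0, 0) = a \<and> f (2 ^ k, 0) = b \<and> f (0, 2 ^ k) = c \<and>
     (0 \<le> a \<and> 0 \<le> b \<and> 0 \<le> c \<longrightarrow> (\<forall>z\<in>G_verts k. 0 \<le> f z)) \<and>
     (\<forall>x. flux (G_bases k) f x = (3 / 5) ^ k / 4 *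
        ((b + c - 2 * a) * of_bool (x = (0, 0)) + (a + c - 2 * b) * of_bool (x = (2 ^ k, 0))
         + (a + b - 2 * c) * of_bool (x = (0, 2 ^ k))))"
proof (induction k arbitrary: a b c)
  case 0
  define f :: "point \<Rightarrow> real" where
    "f x = (if x = (0, 0) then a else if x = (1, 0) then b else c)" for x
  have "flux (G_bases 0) f x = 1 / 4 *
        ((b + c - 2 * a) * of_bool (x = (0, 0)) + (a + c - 2 * b) * of_bool (x = (1, 0))
         + (a + b - 2 * c) * of_bool (x = (0, 1)))" for x
    by (cases x) (auto simp: flux_def sum_bases_at tri_sum_def f_def)
  moreover have "f (0, 0) = a" "f (1, 0) = b" "f (0, 1) = c"
    by (simp_all add: f_def)
  ultimately show ?case
    by (intro exI[of _ f]) (simp del: split_paired_All G_bases.simps)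
next
  case (Suc k)
  let ?d = "(2 * a + 2 * b + c) / 5" and ?e = "(2 * a + b + 2 * c) / 5"
    and ?g = "(a + 2 * b + 2 * c) / 5"
  obtain f0 where f0: "f0 (0, 0) = a" "f0 (2 ^ k, 0) = ?d" "f0 (0, 2 ^ k) = ?e"
    and p0: "0 \<le> a \<and> 0 \<le> ?d \<and> 0 \<le> ?e \<longrightarrow> (\<forall>z\<in>G_verts k. 0 \<le> f0 z)"
    and l0: "\<And>x. flux (G_bases k) f0 x = (3 / 5) ^ k / 4 *
        ((?d + ?e - 2 * a) * of_bool (x = (0, 0)) + (a + ?e - 2 * ?d) * of_bool (x = (2 ^ k, 0))
         + (a + ?d - 2 * ?e) * of_bool (x = (0, 2 ^ k)))"
    using Suc[of a ?d ?e] by blast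
  obtain f1 where f1: "f1 (0, 0) = ?d" "f1 (2 ^ k, 0) = b" "f1 (0, 2 ^ k) = ?g"
    and p1: "0 \<le> ?d \<and> 0 \<le> b \<and> 0 \<le> ?g \<longrightarrow> (\<forall>z\<in>G_verts k. 0 \<le> f1 z)"
    and l1: "\<And>x. flux (G_bases k) f1 x = (3 / 5) ^ k / 4 *
        ((b + ?g - 2 * ?d) * of_bool (x = (0, 0)) + (?d + ?g - 2 * b) * of_bool (x = (2 ^ k, 0))
         + (?d + b - 2 * ?g) * of_bool (x = (0, 2 ^ k)))"
    using Suc[of ?d b ?g] by blast
  obtain f2 where f2: "f2 (0, 0) = ?e" "f2 (2 ^ k, 0) = ?g" "f2 (0, 2 ^ k) = c"
    and p2: "0 \<le> ?e \<and> 0 \<le> ?g \<and> 0 \<le> c \<longrightarrow> (\<forall>z\<in>G_verts k. 0 \<le> f2 z)"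
    and l2: "\<And>x. flux (G_bases k) f2 x = (3 / 5) ^ k / 4 *
        ((?g + c - 2 * ?e) * of_bool (x = (0, 0)) + (?e + c - 2 * ?g) * of_bool (x = (2 ^ k, 0))
         + (?e + ?g - 2 * c) * of_bool (x = (0, 2 ^ k)))"
    using Suc[of ?e ?g c] by blast
  obtain f where e0: "\<And>z. z \<in> G_verts k \<Longrightarrow> f z = f0 z"
    and e1: "\<And>z. z \<in> G_verts k \<Longrightarrow> f ((2 ^ k, 0) + z) = f1 z"
    and e2: "\<And>z. z \<in> G_verts k \<Longrightarrow> f ((0, 2 ^ k) + z) = f2 z"
    and l: "\<And>x. flux (G_bases (Suc k)) f x = flux (G_bases k) f0 x
       + flux (G_bases k) f1 (x - (2 ^ k, 0)) + flux (G_bases k) f2 (x - (0, 2 ^ k))"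
    using glue[of f0 k f1 f2] f0 f1 f2 by metis
  have c0: "f (0, 0) = a"
    using e0[OF origin_in_G_verts] f0 by simp
  have c1: "f (2 ^ Suc k, 0) = b"
    using e1[OF corners_in_G_verts(1)] f1 by simp
  have c2: "f (0, 2 ^ Suc k) = c"
    using e2[OF corners_in_G_verts(2)] f2 by simp
  have pos: "0 \<le> f z" if abc: "0 \<le> a" "0 \<le> b" "0 \<le> c" and z: "z \<in> G_verts (Suc k)" for z
  proof -
    obtain t w where t: "t \<in> shifts k" and w: "w \<in> G_verts k" and "z = t + w"
      using z by auto
    then show ?thesis
      using e0[OF w] e1[OF w] e2[OF w] p0 p1 p2 abc w
      by (auto simp: shifts_def zero_prod_def[symmetric])
  qed
  have fl: "flux (G_bases (Suc k)) f x = (3 / 5) ^ Suc k / 4 *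
        ((b + c - 2 * a) * of_bool (x = (0, 0)) + (a + c - 2 * b) * of_bool (x = (2 ^ Suc k, 0))
         + (a + b - 2 * c) * of_bool (x = (0, 2 ^ Suc k)))" for x
    unfolding l l0 l1 l2 by (cases x) (auto simp: field_simps)
  show ?case using c0 c1 c2 pos fl by blast
qed

text \<open>The potential of a unit flow from the origin to each of the other two corners of \<open>G_k\<close>.\<close>

lemma corner_potential:
  obtains D where "D (2 ^ k, 0) = 0" "D (0, 2 ^ k) = 0" "\<And>z. z \<in> G_verts k \<Longrightarrow> 0 \<le> D z"
    "\<And>x. flux (G_bases k) D x =
       of_bool (x = (2 ^ k, 0)) + of_bool (x = (0, 2 ^ k)) - 2 * of_bool (x = (0, 0))"
proof -
  obtain f where f: "f (2 ^ k, 0) = 0" "f (0, 2 ^ k) = 0"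
    and p: "0 \<le> (4::real) * (5 / 3) ^ k \<longrightarrow> (\<forall>z\<in>G_verts k. 0 \<le> f z)"
    and l: "\<And>x. flux (G_bases k) f x = (3 / 5) ^ k / 4 *
        ((0 + 0 - 2 * (4 * (5 / 3) ^ k)) * of_bool (x = (0, 0))
         + (4 * (5 / 3) ^ k + 0 - 2 * 0) * of_bool (x = (2 ^ k, 0))
         + (4 * (5 / 3) ^ k + 0 - 2 * 0) * of_bool (x = (0, 2 ^ k)))"
    \<comment> \<open>the value at the origin undoes the factor \<open>(3 / 5) ^ k / 4\<close> of the corner fluxes\<close>
    using harmonic_extension[of "4 * (5 / 3) ^ k" k 0 0] by auto
  have q: "(3 / 5) ^ k * (5 / 3) ^ k = (1::real)"
    by (simp flip: power_mult_distrib)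
  have "flux (G_bases k) f x =
       of_bool (x = (2 ^ k, 0)) + of_bool (x = (0, 2 ^ k)) - 2 * of_bool (x = (0, 0))" for x
    unfolding l using q by (auto simp: algebra_simps)
  moreover have "0 \<le> f z" if "z \<in> G_verts k" for z
    using p that by simp
  ultimately show thesis using f by (intro that)
qed

text \<open>Two cells meet at every vertex except for the three outer corners: in \<open>G_(k+1)\<close> a corner at which
two copies meet gets one cell from each.\<close>

lemma two_cells_finite:
  "cell_count (G_bases k) x = 2 * of_bool (x \<in> G_verts k)
     - of_bool (x = (0, 0)) - of_bool (x = (2 ^ k, 0)) - of_bool (x = (0, 2 ^ k))"
proof (induction k arbitrary: x)
  case 0
  show ?case by (cases x) (auto simp: cell_count_def sum_bases_at)
next
  case (Suc k)
  have m: "x \<in> G_verts (Suc k) \<longleftrightarrow>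
    x \<in> G_verts k \<or> x - (2 ^ k, 0) \<in> G_verts k \<or> x - (0, 2 ^ k) \<in> G_verts k"
    by (cases x) (simp add: shifts_def mem_translate_iff)
  have 1: "x \<in> G_verts k \<and> x - (2 ^ k, 0) \<in> G_verts k \<longleftrightarrow> x = (2 ^ k, 0)"
    using G_verts_bounds[of x k] G_verts_bounds[of "x - (2 ^ k, 0)" k]
      corners_in_G_verts[of k] origin_in_G_verts[of k]
    by (cases x) (auto simp: level_def)
  have 2: "x \<in> G_verts k \<and> x - (0, 2 ^ k) \<in> G_verts k \<longleftrightarrow> x = (0, 2 ^ k)"
    using G_verts_bounds[of x k] G_verts_bounds[of "x - (0, 2 ^ k)" k]
      corners_in_G_verts[of k] origin_in_G_verts[of k]
    by (cases x) (auto simp: level_def)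
  have 3: "x - (2 ^ k, 0) \<in> G_verts k \<and> x - (0, 2 ^ k) \<in> G_verts k \<longleftrightarrow> x = (2 ^ k, 2 ^ k)"
    using G_verts_bounds[of "x - (2 ^ k, 0)" k] G_verts_bounds[of "x - (0, 2 ^ k)" k]
      corners_in_G_verts[of k]
    by (cases x) (auto simp: level_def)
  have u: "(of_bool (x \<in> G_verts (Suc k)) :: real) = of_bool (x \<in> G_verts k)
      + of_bool (x - (2 ^ k, 0) \<in> G_verts k) + of_bool (x - (0, 2 ^ k) \<in> G_verts k)
      - of_bool (x = (2 ^ k, 0)) - of_bool (x = (0, 2 ^ k)) - of_bool (x = (2 ^ k, 2 ^ k))"
    unfolding m 1[symmetric] 2[symmetric] 3[symmetric] using 1 2 3 by auto
  have c: "cell_count (G_bases (Suc k)) x = cell_count (G_bases k) x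
       + cell_count (G_bases k) (x - (2 ^ k, 0)) + cell_count (G_bases k) (x - (0, 2 ^ k))"
    using cell_count_below_Suc[of k "2 ^ Suc k" x] by (simp add: below_all del: G_bases.simps)
  show ?case
    unfolding c Suc u by (cases x) (simp add: algebra_simps)
qed

section \<open>The odometer on finite gaskets\<close>

text \<open>The odometer on one side of the gasket, by recursion over the copies. The target distribution
gives each vertex half a unit for every cell of the ball at that vertex, so it decomposes like the
set of cells; \<open>B\<close> is its total mass, to be emitted from the origin.

For \<open>2 ^ k < n\<close> the half ball of radius \<open>n\<close> is \<open>G_k\<close> with two half balls of radius
\<open>m = n - 2 ^ k\<close> attached to its far corners. Their odometer \<open>v\<close> is used on both copies. On \<open>G_k\<close>
itself the odometer of radius \<open>2 ^ k\<close> is corrected by \<open>B\<close> times the corner potential, which brings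
the mass needed by each copy to its corner, and by the constant \<open>v (0, 0)\<close>, which makes the pieces
match; none of this destroys positivity.\<close>

lemma odometer_on_G_verts:
  assumes "n \<le> 2 ^ k"
  shows "\<exists>u B. 0 \<le> B \<and> (\<forall>z\<in>G_verts k. if level z < n then 0 < u z else u z = 0) \<and>
    (\<forall>x. flux (G_bases k) u x = cell_count (below (G_bases k) n) x / 2 - B * of_bool (x = (0, 0)))"
  using assms
proof (induction k arbitrary: n)
  case 0
  show ?case
  proof (cases "n \<le> 0")
    case True
    then show ?thesis
      by (intro exI[of _ "\<lambda>_. 0"] exI[of _ 0])
        (auto simp: below_none level_def cell_count_def simp del: G_bases.simps)
  next
    case False
    \<comment> \<open>on a single cell, \<open>u\<close> sends half a unit to each of the two far corners\<close>
    with 0 have n: "n = 1" by simp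
    define u :: "point \<Rightarrow> real" where "u z = (if z = (0, 0) then 2 else 0)" for z
    have "flux (G_bases 0) u x
        = cell_count (below (G_bases 0) n) x / 2 - (3 / 2) * of_bool (x = (0, 0))" for x
      by (cases x)
        (auto simp: n flux_def cell_count_def below_def sum_bases_at tri_sum_def u_def level_def)
    moreover have "\<forall>z\<in>G_verts 0. if level z < n then 0 < u z else u z = 0"
      by (auto simp: u_def n level_def)
    ultimately show ?thesis
      by (intro exI[of _ u] exI[of _ "3 / 2"]) (simp del: G_bases.simps G_verts.simps)
  qed
next
  case (Suc k)
  define m where "m = n - 2 ^ k"
  have m: "m \<le> 2 ^ k" using Suc.prems by (simp add: m_def)
  obtain v B where B: "0 \<le> B"
    and v: "\<And>z. z \<in> G_verts k \<Longrightarrow> if level z < m then 0 < v z else v z = 0"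
    and lv: "\<And>x. flux (G_bases k) v x
      = cell_count (below (G_bases k) m) x / 2 - B * of_bool (x = (0, 0))"
    using Suc.IH[OF m] by metis
  have v_corners: "v (2 ^ k, 0) = 0" "v (0, 2 ^ k) = 0"
    using v[OF corners_in_G_verts(1)] v[OF corners_in_G_verts(2)] m by (auto simp: level_def)
  have "\<exists>w A. 0 \<le> A \<and> w (2 ^ k, 0) = v (0, 0) \<and> w (0, 2 ^ k) = v (0, 0) \<and>
    (\<forall>z\<in>G_verts k. if level z < n then 0 < w z else w z = 0) \<and>
    (\<forall>x. flux (G_bases k) w x = cell_count (below (G_bases k) n) x / 2 - A * of_bool (x = (0, 0))
       + B * of_bool (x = (2 ^ k, 0)) + B * of_bool (x = (0, 2 ^ k)))"
  proof (cases "m \<le> 0")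
    case True
    then have n: "n \<le> 2 ^ k" by (simp add: m_def)
    have v0: "v z = 0" if "z \<in> G_verts k" for z
      using v[OF that] G_verts_bounds[OF that] True by (auto simp: level_def split: if_splits)
    have "flux (G_bases k) v (0, 0) = flux (G_bases k) (\<lambda>_. 0) (0, 0)"
      by (rule flux_cong, rule v0) (auto simp: G_verts_eq_cells)
    then have B0: "B = 0"
      using lv[of "(0, 0)"] True by (simp add: below_none cell_count_def)
    \<comment> \<open>the ball does not reach beyond \<open>G_k\<close>: the copies carry the zero function\<close>
    obtain w A where "0 \<le> A"
      and w: "\<forall>z\<in>G_verts k. if level z < n then 0 < w z else w z = 0"
      and "\<forall>x. flux (G_bases k) w x
        = cell_count (below (G_bases k) n) x / 2 - A * of_bool (x = (0, 0))"
      using Suc.IH[OF n] by metis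
    moreover have "w (2 ^ k, 0) = 0" "w (0, 2 ^ k) = 0"
      using w corners_in_G_verts[of k] n by (auto simp: level_def)
    ultimately show ?thesis
      using v0[OF origin_in_G_verts] by (intro exI[of _ w] exI[of _ A]) (simp add: B0)
  next
    case False
    then have n: "2 ^ k < n" by (simp add: m_def)
    obtain w A where A: "0 \<le> A"
      and w: "\<And>z. z \<in> G_verts k \<Longrightarrow> if level z < 2 ^ k then 0 < w z else w z = 0"
      and lw: "\<And>x. flux (G_bases k) w x
        = cell_count (below (G_bases k) (2 ^ k)) x / 2 - A * of_bool (x = (0, 0))"
      using Suc.IH[of "2 ^ k"] by (metis order_refl)
    obtain D where D: "D (2 ^ k, 0) = 0" "D (0, 2 ^ k) = 0"
      "\<And>z. z \<in> G_verts k \<Longrightarrow> 0 \<le> D z"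
      and lD: "\<And>x. flux (G_bases k) D x =
       of_bool (x = (2 ^ k, 0)) + of_bool (x = (0, 2 ^ k)) - 2 * of_bool (x = (0, 0))"
      using corner_potential[of k] by blast
    define w' where "w' z = w z + B * D z + v (0, 0)" for z
    have v0: "0 < v (0, 0)"
      using v[OF origin_in_G_verts] False by (auto simp: level_def)
    have w0: "0 \<le> w z" if "z \<in> G_verts k" for z
      using w[OF that] by (auto split: if_splits)
    have "w' (2 ^ k, 0) = v (0, 0)" "w' (0, 2 ^ k) = v (0, 0)"
      using w[OF corners_in_G_verts(1)] w[OF corners_in_G_verts(2)] D
      by (auto simp: level_def w'_def)
    moreover have "if level z < n then 0 < w' z else w' z = 0" if z: "z \<in> G_verts k" for z
    proof -
      have "0 < w' z" unfolding w'_def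
        using w0[OF z] v0 mult_nonneg_nonneg[OF B D(3)[OF z]] by linarith
      then show ?thesis using G_verts_bounds[OF z] n by simp
    qed
    moreover have "flux (G_bases k) w' x
      = cell_count (below (G_bases k) n) x / 2 - (A + 2 * B) * of_bool (x = (0, 0))
       + B * of_bool (x = (2 ^ k, 0)) + B * of_bool (x = (0, 2 ^ k))" for x
      unfolding w'_def flux_affine lw lD using n by (simp add: below_all algebra_simps)
    ultimately show ?thesis using A B
      by (intro exI[of _ w'] exI[of _ "A + 2 * B"]) simp
  qed
  then obtain w A where A: "0 \<le> A" and wv: "w (2 ^ k, 0) = v (0, 0)" "w (0, 2 ^ k) = v (0, 0)"
    and w: "\<And>z. z \<in> G_verts k \<Longrightarrow> if level z < n then 0 < w z else w z = 0"
    and lw: "\<And>x. flux (G_bases k) w x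
       = cell_count (below (G_bases k) n) x / 2 - A * of_bool (x = (0, 0))
       + B * of_bool (x = (2 ^ k, 0)) + B * of_bool (x = (0, 2 ^ k))" by metis
  obtain u where e0: "\<And>z. z \<in> G_verts k \<Longrightarrow> u z = w z"
    and e1: "\<And>z. z \<in> G_verts k \<Longrightarrow> u ((2 ^ k, 0) + z) = v z"
    and e2: "\<And>z. z \<in> G_verts k \<Longrightarrow> u ((0, 2 ^ k) + z) = v z"
    and lu: "\<And>x. flux (G_bases (Suc k)) u x = flux (G_bases k) w x
       + flux (G_bases k) v (x - (2 ^ k, 0)) + flux (G_bases k) v (x - (0, 2 ^ k))"
    using glue[of w k v v] wv v_corners by metis
  have "if level z < n then 0 < u z else u z = 0" if z: "z \<in> G_verts (Suc k)" for z
  proof -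
    obtain t y where t: "t \<in> shifts k" and y: "y \<in> G_verts k" and zt: "z = t + y"
      using z by auto
    from t consider "t = (0, 0)" | "t = (2 ^ k, 0)" | "t = (0, 2 ^ k)" by (auto simp: shifts_def)
    then show ?thesis
    proof cases
      case 1
      then have "z = y" using zt by (simp add: zero_prod_def[symmetric])
      then show ?thesis using w[OF y] e0[OF y] by simp
    next
      case 2
      then have "level z = 2 ^ k + level y" using zt by (simp add: level_def)
      then show ?thesis using v[OF y] e1[OF y] 2 zt by (auto simp: m_def split: if_splits)
    next
      case 3
      then have "level z = 2 ^ k + level y" using zt by (simp add: level_def)
      then show ?thesis using v[OF y] e2[OF y] 3 zt by (auto simp: m_def split: if_splits)
    qed
  qed
  moreover have "flux (G_bases (Suc k)) u x
      = cell_count (below (G_bases (Suc k)) n) x / 2 - A * of_bool (x = (0, 0))" for x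
    unfolding lu lw lv cell_count_below_Suc m_def[symmetric]
    by (cases x) (simp add: algebra_simps add_divide_distrib)
  ultimately show ?case using A by blast
qed

section \<open>Passage to the infinite gasket\<close>

lemma G_bases_mono: "j \<le> k \<Longrightarrow> G_bases j \<subseteq> G_bases k"
proof (rule lift_Suc_mono_le)
  show "G_bases i \<subseteq> G_bases (Suc i)" for i
    by (auto simp: shifts_def zero_prod_def[symmetric])
qed

text \<open>Later copies are attached at distance at least \<open>2 ^ k\<close>, so the cells near the origin are already
those of \<open>G_k\<close>.\<close>

lemma G_bases_low:
  assumes "p \<in> G_bases j" "level p < 2 ^ k"
  shows "p \<in> G_bases k"
proof (cases "j \<le> k")
  case True
  then show ?thesis using G_bases_mono assms(1) by blast
next
  case False
  then show ?thesis using assms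
  proof (induction j)
    case (Suc j)
    have "(2::int) ^ k \<le> 2 ^ j" using Suc.prems(1) by (intro power_increasing) auto
    moreover obtain t q where "t \<in> shifts j" "q \<in> G_bases j" "p = t + q" using Suc.prems by auto
    ultimately have "p \<in> G_bases j"
      using G_bases_bounds[of q j] Suc.prems(3) unfolding shifts_def
      by (smt (verit) level_def level_add add.left_neutral empty_iff fst_conv insertE snd_conv
          zero_prod_def)
    then show ?case using Suc by (cases "j \<le> k") (auto dest: G_bases_mono)
  qed simp
qed

lemma SG_bases_low: "level p < 2 ^ k \<Longrightarrow> p \<in> SG_bases \<longleftrightarrow> p \<in> G_bases k"
  using G_bases_low unfolding SG_bases_def by blast

lemma SG_plus_eq_cells: "SG_plus = (\<Union>p\<in>SG_bases. tri p)"
  by (auto simp: SG_plus_def SG_bases_def G_verts_eq_cells)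

lemma SG_plus_edges_eq_cells:
  "SG_plus_edges = {(u, v). u \<noteq> v \<and> (\<exists>p\<in>SG_bases. u \<in> tri p \<and> v \<in> tri p)}"
  by (auto simp: SG_plus_edges_def SG_bases_def G_edges_eq_cells)

lemma ex_power_greater: "\<exists>k. n < (2::int) ^ k"
  by (metis ex_le_of_int of_int_le_iff real_arch_pow one_less_numeral_iff semiring_norm(76)
    of_int_less_iff of_int_power of_int_numeral order_le_less_trans)

lemma SG_plus_bounds: "z \<in> SG_plus \<Longrightarrow> 0 \<le> fst z \<and> 0 \<le> snd z"
  using G_verts_bounds unfolding SG_plus_def by blast

lemma two_cells_SG_plus:
  "cell_count SG_bases x = 2 * of_bool (x \<in> SG_plus) - of_bool (x = (0, 0))"
proof -
  obtain k where k: "level x < 2 ^ k" using ex_power_greater by blast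
  have b: "p \<in> SG_bases \<longleftrightarrow> p \<in> G_bases k" if "p \<in> bases_at x" for p
    using that k by (intro SG_bases_low) (auto simp: bases_at_def level_def)
  have "x \<in> SG_plus \<longleftrightarrow> x \<in> G_verts k"
    unfolding SG_plus_eq_cells G_verts_eq_cells using b by (auto simp: bases_at_iff)
  moreover have "cell_count SG_bases x = cell_count (G_bases k) x"
    unfolding cell_count_def using b by simp
  moreover have "x \<noteq> (2 ^ k, 0)" "x \<noteq> (0, 2 ^ k)" using k by (auto simp: level_def)
  ultimately show ?thesis by (simp add: two_cells_finite)
qed

text \<open>Choosing \<open>2 ^ k > n\<close>, the odometer on \<open>G_k\<close> is already zero in the last layer of \<open>G_k\<close>, so its
extension by zero creates no new flux.\<close>

lemma odometer_on_SG_plus: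
  "\<exists>u. (\<forall>z\<in>SG_plus. if level z < n then 0 < u z else u z = 0) \<and>
    (\<forall>x. x \<noteq> (0, 0) \<longrightarrow> flux SG_bases u x = cell_count (below SG_bases n) x / 2)"
proof -
  obtain k where k: "n < 2 ^ k" using ex_power_greater by blast
  then obtain v B
    where v: "\<And>z. z \<in> G_verts k \<Longrightarrow> if level z < n then 0 < v z else v z = 0"
      and lv: "\<And>x. flux (G_bases k) v x
        = cell_count (below (G_bases k) n) x / 2 - B * of_bool (x = (0, 0))"
    using odometer_on_G_verts[of n k] by (metis less_imp_le)
  define u where "u z = (if z \<in> G_verts k then v z else 0)" for z
  have in_G: "z \<in> G_verts k" if "z \<in> SG_plus" "level z < n" for z
  proof -
    obtain p where "p \<in> SG_bases" "z \<in> tri p" using \<open>z \<in> SG_plus\<close> by (auto simp: SG_plus_eq_cells)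
    moreover from this have "level p < 2 ^ k" using level_tri[of z p] that(2) k by simp
    ultimately show ?thesis by (auto simp: SG_bases_low G_verts_eq_cells)
  qed
  have "flux SG_bases u x = cell_count (below SG_bases n) x / 2" if x: "x \<noteq> (0, 0)" for x
  proof (cases "level x < 2 ^ k")
    case True
    have b: "p \<in> SG_bases \<longleftrightarrow> p \<in> G_bases k" if "p \<in> bases_at x" for p
      using that True by (intro SG_bases_low) (auto simp: bases_at_def level_def)
    have "flux SG_bases u x = flux (G_bases k) u x"
      unfolding flux_def using b by simp
    also have "\<dots> = flux (G_bases k) v x"
      by (rule flux_cong) (auto simp: u_def G_verts_eq_cells)
    also have "\<dots> = cell_count (below SG_bases n) x / 2"
      unfolding lv cell_count_def below_def using b x by simp
    finally show ?thesis .
  next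
    case False
    have lev: "n \<le> level p" if "p \<in> bases_at x" for p
      using that False k by (auto simp: bases_at_def level_def)
    have u0: "u z = 0" if "n \<le> level z" for z
      using that v[of z] by (auto simp: u_def)
    have "u z = 0" if "p \<in> bases_at x" "z \<in> tri p" for p z
      using lev[OF that(1)] level_tri[OF that(2)] u0 by simp
    moreover have "x \<in> tri x" by (simp add: tri_def)
    ultimately have "flux SG_bases u x = 0"
      using u0[of x] lev[of x] by (auto simp: flux_def tri_sum_def tri_def bases_at_def)
    moreover have "cell_count (below SG_bases n) x = 0"
      using lev by (fastforce simp: cell_count_def below_def)
    ultimately show ?thesis by simp
  qed
  moreover have "if level z < n then 0 < u z else u z = 0" if z: "z \<in> SG_plus" for z
    using v[of z] in_G[OF z] by (auto simp: u_def split: if_splits)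
  ultimately show ?thesis by blast
qed

section \<open>The Laplacian as a flux\<close>

lemma sum_tri: "(\<Sum>z\<in>tri p. f z) = tri_sum f p"
  by (cases p) (simp add: tri_def tri_sum_def)

lemma tri_inter:
  assumes "x \<in> tri p" "x \<in> tri q" "y \<in> tri p" "y \<in> tri q" "x \<noteq> y"
  shows "p = q"
  using assms by (cases p; cases q; cases x; cases y) (auto simp: tri_def)

text \<open>Two distinct triangles share at most one vertex, so the neighbours of \<open>x\<close> are distributed over the
cells at \<open>x\<close> without repetition.\<close>

lemma sum_SG_plus_neighbours:
  "(\<Sum>y | (x, y) \<in> SG_plus_edges. f y)
     = 4 * flux SG_bases f x + 2 * f x * cell_count SG_bases x"
proof -
  have U: "{y. (x, y) \<in> SG_plus_edges} = (\<Union>p\<in>bases_at x \<inter> SG_bases. tri p - {x})"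
    by (auto simp: SG_plus_edges_eq_cells bases_at_iff)
  have fin: "finite (tri p)" for p by (simp add: tri_def)
  have disj: "(tri p - {x}) \<inter> (tri q - {x}) = {}"
    if "p \<in> bases_at x \<inter> SG_bases" "q \<in> bases_at x \<inter> SG_bases" "p \<noteq> q" for p q
    using that tri_inter[of x p q] by (auto simp: bases_at_iff)
  have "(\<Sum>y | (x, y) \<in> SG_plus_edges. f y)
      = (\<Sum>p\<in>bases_at x \<inter> SG_bases. \<Sum>y\<in>tri p - {x}. f y)"
    unfolding U by (rule sum.UNION_disjoint) (use fin disj in auto)
  also have "\<dots> = (\<Sum>p\<in>bases_at x \<inter> SG_bases. tri_sum f p - f x)"
    by (intro sum.cong) (auto simp: sum_diff1 sum_tri bases_at_iff fin)
  also have "\<dots> = (\<Sum>p\<in>bases_at x. of_bool (p \<in> SG_bases) * (tri_sum f p - f x))"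
    by (intro sum.mono_neutral_cong_left) auto
  also have "\<dots> = 4 * flux SG_bases f x + 2 * f x * cell_count SG_bases x"
    unfolding flux_def cell_count_def sum_distrib_left sum.distrib[symmetric]
    by (intro sum.cong) (auto simp: field_simps)
  finally show ?thesis .
qed

lemma SG_plus_edges_verts:
  assumes "(x, y) \<in> SG_plus_edges"
  shows "x \<in> SG_plus" "y \<in> SG_plus" "x \<noteq> y"
  using assms by (auto simp: SG_plus_edges_eq_cells SG_plus_eq_cells)

lemma SG_plus_inter_neg: "x \<in> SG_plus \<Longrightarrow> - x \<in> SG_plus \<Longrightarrow> x = (0, 0)"
  using SG_plus_bounds[of x] SG_plus_bounds[of "- x"] by (cases x) auto

lemma neg_mem_SG: "- x \<in> SG \<longleftrightarrow> x \<in> SG"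
  by (force simp: SG_def image_iff)

lemma neighbours_eq:
  "neighbours x = {y. (x, y) \<in> SG_plus_edges} \<union> uminus ` {y. (- x, y) \<in> SG_plus_edges}"
  by (force simp: neighbours_def SG_edges_def image_iff)

text \<open>The two halves of the gasket contribute separately, and together they have exactly two cells at
every vertex: at the origin one from each half.\<close>

lemma laplacian_eq_flux:
  assumes x: "x \<in> SG"
  shows "laplacian f x = flux SG_bases f x + flux SG_bases (\<lambda>z. f (- z)) (- x)"
proof -
  have "cell_count SG_bases x + cell_count SG_bases (- x) = 2"
    using x SG_plus_inter_neg[of x] SG_plus_inter_neg[of "- x"] unfolding two_cells_SG_plus SG_def
    by (cases x) (auto simp: image_iff)
  have fin: "finite {y. (x, y) \<in> SG_plus_edges}" "finite (uminus ` {y. (- x, y) \<in> SG_plus_edges})"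
    using finite_neighbours[of x] unfolding neighbours_eq by auto
  have disj: "{y. (x, y) \<in> SG_plus_edges} \<inter> uminus ` {y. (- x, y) \<in> SG_plus_edges} = {}"
  proof -
    have False if e: "(x, - y) \<in> SG_plus_edges" "(- x, y) \<in> SG_plus_edges" for y
    proof -
      have "x = (0, 0)" "y = (0, 0)"
        using SG_plus_edges_verts[OF e(1)] SG_plus_edges_verts[OF e(2)] SG_plus_inter_neg by blast+
      then show False using SG_plus_edges_verts(3)[OF e(1)] by simp
    qed
    then show ?thesis by blast
  qed
  have "(\<Sum>y\<in>neighbours x. f y) = (\<Sum>y | (x, y) \<in> SG_plus_edges. f y)
      + (\<Sum>y | (- x, y) \<in> SG_plus_edges. f (- y))"
    unfolding neighbours_eq sum.union_disjoint[OF fin disj]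
    by (subst sum.reindex) auto
  also have "\<dots> = 4 * flux SG_bases f x + 4 * flux SG_bases (\<lambda>z. f (- z)) (- x)
      + 2 * f x * (cell_count SG_bases x + cell_count SG_bases (- x))"
    unfolding sum_SG_plus_neighbours by (simp add: algebra_simps)
  finally show ?thesis
    unfolding \<open>cell_count SG_bases x + cell_count SG_bases (- x) = 2\<close> laplacian_def
    by (simp add: add_divide_distrib)
qed

section \<open>The target distribution\<close>

definition ball_density :: "int \<Rightarrow> point \<Rightarrow> real" where
  "ball_density n z = (if z \<in> SG_ball n - inner_boundary (SG_ball n) then 1
     else if z \<in> inner_boundary (SG_ball n) then 1 / 2 else 0)"

lemma neg_mem_SG_ball: "- z \<in> SG_ball n \<longleftrightarrow> z \<in> SG_ball n"
  using neg_mem_SG[of z] by (cases z) (simp add: SG_ball_def)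

lemma neg_mem_SG_edges: "(- u, - v) \<in> SG_edges \<longleftrightarrow> (u, v) \<in> SG_edges"
proof -
  have "(- u, - v) \<in> SG_edges" if "(u, v) \<in> SG_edges" for u v
    using that by (cases u; cases v) (force simp: SG_edges_def image_iff)
  from this[of u v] this[of "- u" "- v"] show ?thesis by auto
qed

lemma neg_mem_inner_boundary:
  "- z \<in> inner_boundary (SG_ball n) \<longleftrightarrow> z \<in> inner_boundary (SG_ball n)"
proof -
  have "- z \<in> inner_boundary (SG_ball n)" if z: "z \<in> inner_boundary (SG_ball n)" for z
  proof -
    obtain v where "v \<in> SG - SG_ball n" "(z, v) \<in> SG_edges"
      using z unfolding inner_boundary_def by blast
    then have "- v \<in> SG - SG_ball n" "(- z, - v) \<in> SG_edges"
      by (simp_all add: neg_mem_SG neg_mem_SG_ball neg_mem_SG_edges)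
    then show ?thesis using z by (auto simp: inner_boundary_def neg_mem_SG_ball)
  qed
  from this[of z] this[of "- z"] show ?thesis by auto
qed

lemma SG_plus_ball_iff: "z \<in> SG_plus \<Longrightarrow> z \<in> SG_ball n \<longleftrightarrow> level z \<le> n"
  using SG_plus_bounds[of z] by (cases z) (auto simp: SG_ball_def SG_def level_def)

text \<open>A vertex has neighbours farther from the origin exactly if it is the address of a cell. Vertices at
distance \<open>n\<close> that address no cell therefore belong to the interior of the ball.\<close>

lemma inner_boundary_iff:
  assumes z: "z \<in> SG_plus" "z \<noteq> (0, 0)"
  shows "z \<in> inner_boundary (SG_ball n) \<longleftrightarrow> level z = n \<and> z \<in> SG_bases"
proof
  assume "z \<in> inner_boundary (SG_ball n)"
  then obtain v where zn: "z \<in> SG_ball n" and v: "v \<notin> SG_ball n" and e: "v \<in> neighbours z"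
    by (auto simp: inner_boundary_def neighbours_def)
  have "- z \<notin> SG_plus" using SG_plus_inter_neg z by blast
  with e have "(z, v) \<in> SG_plus_edges"
    unfolding neighbours_eq using SG_plus_edges_verts by blast
  then obtain p where p: "p \<in> SG_bases" "z \<in> tri p" "v \<in> tri p" and "v \<in> SG_plus"
    by (auto simp: SG_plus_edges_eq_cells SG_plus_eq_cells)
  then have "n < level v" "level z \<le> n"
    using v zn z SG_plus_ball_iff by auto
  moreover have "level z = level p \<longrightarrow> z = p" using p(2) by (auto simp: tri_def level_def)
  ultimately show "level z = n \<and> z \<in> SG_bases"
    using level_tri[OF p(2)] level_tri[OF p(3)] p(1) by auto
next
  assume a: "level z = n \<and> z \<in> SG_bases"
  let ?v = "z + (1, 0)"
  have "z \<in> tri z" "?v \<in> tri z" "z \<noteq> ?v" by (cases z; simp add: tri_def)+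
  then have e: "(z, ?v) \<in> SG_plus_edges" using a unfolding SG_plus_edges_eq_cells by blast
  then have "?v \<in> SG_plus" by (rule SG_plus_edges_verts)
  moreover from this have "?v \<notin> SG_ball n"
    using a by (simp add: SG_plus_ball_iff level_def)
  moreover have "z \<in> SG_ball n" using a z by (simp add: SG_plus_ball_iff)
  ultimately show "z \<in> inner_boundary (SG_ball n)"
    using e unfolding inner_boundary_def SG_def SG_edges_def by blast
qed

text \<open>The cells of the ball of radius \<open>n\<close> are those whose address has level below \<open>n\<close>. An interior vertex
has both of its cells inside the ball, a boundary vertex just the one on the side of the origin. The
origin is excluded because for \<open>n = 0\<close> it is a boundary vertex, while the ball contains no cell.\<close>

lemma ball_density_eq_cell_count_plus:
  assumes z: "z \<in> SG_plus" "z \<noteq> (0, 0)"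
  shows "ball_density n z = cell_count (below SG_bases n) z / 2"
proof -
  have two: "cell_count SG_bases z = 2" using z by (simp add: two_cells_SG_plus)
  have b: "level (z - (1, 0)) = level z - 1" "level (z - (0, 1)) = level z - 1"
    by (simp_all add: level_def)
  consider "level z < n" | "level z = n" | "n < level z" by linarith
  then show ?thesis
  proof cases
    case 1
    then have "cell_count (below SG_bases n) z = cell_count SG_bases z"
      unfolding cell_count_def sum_bases_at below_def using b by simp
    moreover have "z \<in> SG_ball n - inner_boundary (SG_ball n)"
      using 1 z by (simp add: SG_plus_ball_iff inner_boundary_iff)
    ultimately show ?thesis using two by (simp add: ball_density_def)
  next
    case 2
    then have "cell_count (below SG_bases n) z = cell_count SG_bases z - of_bool (z \<in> SG_bases)"
      unfolding cell_count_def sum_bases_at below_def using b by simp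
    moreover have "z \<in> SG_ball n"
      using 2 z by (simp add: SG_plus_ball_iff)
    ultimately show ?thesis using two 2 z by (simp add: ball_density_def inner_boundary_iff)
  next
    case 3
    then have "cell_count (below SG_bases n) z = 0"
      unfolding cell_count_def sum_bases_at below_def using b by simp
    moreover have "z \<notin> SG_ball n" "z \<notin> inner_boundary (SG_ball n)"
      using 3 z by (simp_all add: SG_plus_ball_iff inner_boundary_iff)
    ultimately show ?thesis by (simp add: ball_density_def)
  qed
qed

lemma ball_density_eq_cell_count:
  assumes z: "z \<in> SG" "z \<noteq> (0, 0)"
  shows "ball_density n z
    = (cell_count (below SG_bases n) z + cell_count (below SG_bases n) (- z)) / 2"
proof -
  have none: "cell_count (below SG_bases n) y = 0" if "y \<notin> SG_plus" for y
    using that by (auto simp: SG_plus_eq_cells cell_count_def below_def bases_at_iff)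
  have "z \<in> SG_plus \<or> - z \<in> SG_plus" using z by (auto simp: SG_def)
  then show ?thesis
  proof
    assume "z \<in> SG_plus"
    moreover from this have "- z \<notin> SG_plus" using SG_plus_inter_neg z by blast
    ultimately show ?thesis using none z by (simp add: ball_density_eq_cell_count_plus)
  next
    assume m: "- z \<in> SG_plus"
    moreover from this have "z \<notin> SG_plus" using SG_plus_inter_neg z by blast
    moreover have "- z \<noteq> (0, 0)" using z(2) by (cases z) simp
    moreover have "ball_density n z = ball_density n (- z)"
      by (simp add: ball_density_def neg_mem_SG_ball neg_mem_inner_boundary)
    ultimately show ?thesis using none by (simp add: ball_density_eq_cell_count_plus)
  qed
qed

lemma laplacian_add_scaled:
  "laplacian (\<lambda>y. f y + c * g y) x = laplacian f x + c * laplacian g x"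
  by (simp add: laplacian_def sum.distrib sum_distrib_left[symmetric] algebra_simps)

lemma card_neighbours:
  assumes "x \<in> SG"
  shows "card (neighbours x) = 4"
proof -
  have "laplacian (\<lambda>_. 1) x = 0"
    unfolding laplacian_eq_flux[OF assms] by (simp add: flux_def tri_sum_def)
  then show ?thesis by (simp add: laplacian_def)
qed

text \<open>Conservation of mass: by regularity of degree four, what a vertex of the smaller ball emits arrives
at its neighbours, all of them in the larger ball.\<close>

lemma sum_laplacian_eq_0:
  assumes w: "\<And>z. z \<in> SG \<Longrightarrow> z \<notin> SG_ball (n - 1) \<Longrightarrow> w z = 0"
  shows "(\<Sum>x\<in>SG_ball n. laplacian w x) = 0"
proof -
  let ?A = "SG_ball n" and ?B = "SG_ball (n - 1)"
  have nb: "neighbours y \<subseteq> ?A" if "y \<in> ?B" for y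
  proof
    fix x assume "x \<in> neighbours y"
    with that SG_edges_bounds(2,7)[of y x] show "x \<in> ?A"
      by (auto simp: neighbours_def SG_ball_def)
  qed
  have sub: "?B \<subseteq> ?A" "?A \<subseteq> SG" by (auto simp: SG_ball_def)
  have "(\<Sum>x\<in>?A. \<Sum>y\<in>neighbours x. w y) = (\<Sum>x\<in>?A. \<Sum>y\<in>?B. of_bool (y \<in> neighbours x) * w y)"
  proof (rule sum.cong[OF refl])
    fix x assume "x \<in> ?A"
    have "(\<Sum>y\<in>neighbours x. w y) = (\<Sum>y\<in>neighbours x \<inter> ?B. w y)"
    proof (rule sum.mono_neutral_right[OF finite_neighbours])
      have "w y = 0" if "y \<in> neighbours x" "y \<notin> ?B" for y
        using w[of y] SG_edges_bounds(2)[of x y] that by (simp add: neighbours_def)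
      then show "\<forall>y\<in>neighbours x - neighbours x \<inter> ?B. w y = 0" by blast
    qed simp
    also have "\<dots> = (\<Sum>y\<in>?B. of_bool (y \<in> neighbours x) * w y)"
      by (intro sum.mono_neutral_cong_left) (auto simp: finite_SG_ball)
    finally show "(\<Sum>y\<in>neighbours x. w y) = (\<Sum>y\<in>?B. of_bool (y \<in> neighbours x) * w y)" .
  qed
  also have "\<dots> = (\<Sum>y\<in>?B. \<Sum>x\<in>?A. of_bool (y \<in> neighbours x) * w y)"
    by (rule sum.swap)
  also have "\<dots> = (\<Sum>y\<in>?B. 4 * w y)"
  proof (rule sum.cong[OF refl])
    fix y assume y: "y \<in> ?B"
    have "y \<in> neighbours x \<longleftrightarrow> x \<in> neighbours y" for x
      unfolding neighbours_def using SG_edges_bounds(4) by blast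
    then have "(\<Sum>x\<in>?A. of_bool (y \<in> neighbours x) * w y) = (\<Sum>x\<in>neighbours y. w y)"
      using nb[OF y] by (intro sum.mono_neutral_cong_right) (auto simp: finite_SG_ball)
    then show "(\<Sum>x\<in>?A. of_bool (y \<in> neighbours x) * w y) = 4 * w y"
      using card_neighbours[of y] y sub by auto
  qed
  also have "\<dots> = 4 * (\<Sum>y\<in>?A. w y)"
    unfolding sum_distrib_left using sub w by (intro sum.mono_neutral_left) (auto simp: finite_SG_ball)
  finally show ?thesis
    by (simp add: laplacian_def sum_subtractf sum_divide_distrib[symmetric])
qed

lemma sum_ball_density: "(\<Sum>z\<in>SG_ball n. ball_density n z) = ball_mass n"
proof -
  let ?A = "SG_ball n" and ?I = "inner_boundary (SG_ball n)"
  have sub: "?I \<subseteq> ?A" by (auto simp: inner_boundary_def)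
  have "(\<Sum>z\<in>?A. ball_density n z) = (\<Sum>z\<in>?A. 1 - 1 / 2 * of_bool (z \<in> ?I))"
    using sub by (intro sum.cong) (auto simp: ball_density_def)
  also have "\<dots> = ball_mass n"
    using sub finite_SG_ball[of n]
    by (simp add: ball_mass_def sum_subtractf Int_absorb1 flip: sum_divide_distrib)
  finally show ?thesis .
qed

text \<open>The one-sided odometer is used on both halves of the gasket. This accounts for the Laplacian away
from the origin; at the origin it is determined by conservation of mass, since the densities of the
ball add up to \<open>ball_mass n\<close>.\<close>

lemma ball_odometer:
  obtains w where "\<And>z. z \<in> SG_ball (n - 1) \<Longrightarrow> 0 < w z"
    "\<And>z. z \<in> SG \<Longrightarrow> z \<notin> SG_ball (n - 1) \<Longrightarrow> w z = 0"
    "\<And>z. z \<in> SG \<Longrightarrow> ball_mass n * indicat_real {(0, 0)} z + laplacian w z = ball_density n z"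
proof -
  obtain u where u: "\<And>z. z \<in> SG_plus \<Longrightarrow> if level z < n then 0 < u z else u z = 0"
    and lu: "\<And>x. x \<noteq> (0, 0) \<Longrightarrow> flux SG_bases u x = cell_count (below SG_bases n) x / 2"
    using odometer_on_SG_plus[of n] by metis
  define w where "w z = u (\<bar>fst z\<bar>, \<bar>snd z\<bar>)" for z :: point
  have w_plus: "w z = u z" "w (- z) = u z" if "z \<in> SG_plus" for z
    using SG_plus_bounds[OF that] by (cases z; simp add: w_def)+
  have w: "if z \<in> SG_ball (n - 1) then 0 < w z else w z = 0" if z: "z \<in> SG" for z
  proof -
    obtain y where y: "y \<in> SG_plus" "z = y \<or> z = - y"
      using z unfolding SG_def by blast
    have "z \<in> SG_ball (n - 1) \<longleftrightarrow> level y < n"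
      using y SG_plus_ball_iff[OF y(1), of "n - 1"] by (auto simp: neg_mem_SG_ball)
    then show ?thesis using u[OF y(1)] w_plus[OF y(1)] y(2) by auto
  qed
  have cells: "z \<in> SG_plus" if "p \<in> SG_bases" "z \<in> tri p" for p z
    using that by (auto simp: SG_plus_eq_cells)
  have f: "flux SG_bases w x = flux SG_bases u x"
    "flux SG_bases (\<lambda>z. w (- z)) x = flux SG_bases u x" for x
    using cells w_plus by (auto intro!: flux_cong)
  have off: "laplacian w z = ball_density n z" if "z \<in> SG" "z \<noteq> (0, 0)" for z
  proof -
    have "- z \<noteq> (0, 0)" using that(2) by (cases z) simp
    then show ?thesis
      using that by (simp add: laplacian_eq_flux f lu ball_density_eq_cell_count add_divide_distrib)
  qed
  have w0: "w z = 0" if "z \<in> SG" "z \<notin> SG_ball (n - 1)" for z using w[OF that(1)] that(2) by simp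
  have "ball_mass n + laplacian w (0, 0) = ball_density n (0, 0)"
  proof (cases "n < 0")
    case True
    then have "w z = 0" if "z \<in> SG" for z using w0[OF that] by (simp add: SG_ball_negative)
    then have "laplacian w (0, 0) = 0"
      using origin_in_SG SG_edges_bounds(2) unfolding laplacian_def neighbours_def
      by (auto intro!: sum.neutral)
    then show ?thesis
      using True by (simp add: ball_mass_def ball_density_def inner_boundary_def SG_ball_negative)
  next
    case False
    then have o: "(0, 0) \<in> SG_ball n" using origin_in_SG by (simp add: SG_ball_def)
    have "(\<Sum>z\<in>SG_ball n - {(0, 0)}. laplacian w z) = (\<Sum>z\<in>SG_ball n - {(0, 0)}. ball_density n z)"
      by (intro sum.cong refl off) (auto simp: SG_ball_def)
    then show ?thesis
      using sum_laplacian_eq_0[of n w, OF w0] sum_ball_density[of n]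
      by (simp add: sum_diff1 finite_SG_ball o)
  qed
  then have "ball_mass n * indicat_real {(0, 0)} z + laplacian w z = ball_density n z" if "z \<in> SG" for z
    using off[OF that] by (cases "z = (0, 0)") (simp_all del: split_paired_All)
  moreover have "0 < w z" if "z \<in> SG_ball (n - 1)" for z
  proof -
    have "z \<in> SG" using that by (auto simp: SG_ball_def)
    then show ?thesis using w that by auto
  qed
  ultimately show thesis using w0 that by blast
qed

section \<open>Maximum principle\<close>

text \<open>Every vertex descends to the origin along edges, so a property that passes to neighbours holds
everywhere or nowhere.\<close>

lemma connected_SG:
  assumes step: "\<And>x y. P x \<Longrightarrow> (x, y) \<in> SG_edges \<Longrightarrow> P y" and "z \<in> SG"
  shows "P z \<longleftrightarrow> P (0, 0)"
  using \<open>z \<in> SG\<close>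
proof (induction "nat (\<bar>fst z\<bar> + \<bar>snd z\<bar>)" arbitrary: z rule: less_induct)
  case less
  show ?case
  proof (cases "z = (0, 0)")
    case False
    from SG_descent[OF less.prems this] obtain y where
      y: "(y, z) \<in> SG_edges" "\<bar>fst y\<bar> + \<bar>snd y\<bar> = \<bar>fst z\<bar> + \<bar>snd z\<bar> - 1" by blast
    have "P y \<longleftrightarrow> P (0, 0)"
      using y SG_edges_bounds(1)[OF y(1)] by (intro less.hyps) auto
    moreover have "P y \<longleftrightarrow> P z" using step y(1) SG_edges_bounds(4) by blast
    ultimately show ?thesis by simp
  qed simp
qed

text \<open>At a positive maximum inside the ball, subharmonicity forces all neighbours to have the same
value; by connectedness this spreads to the corner \<open>(2 ^ k, 0)\<close> outside the ball, where the
function vanishes.\<close>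

lemma maximum_principle:
  assumes nonneg: "\<And>z. z \<in> SG \<Longrightarrow> 0 \<le> d z"
    and out: "\<And>z. z \<in> SG \<Longrightarrow> z \<notin> SG_ball m \<Longrightarrow> d z = 0"
    and sub: "\<And>z. z \<in> SG_ball m \<Longrightarrow> 0 \<le> laplacian d z"
    and "z \<in> SG"
  shows "d z = 0"
proof (rule ccontr)
  assume "d z \<noteq> 0"
  then have z: "z \<in> SG_ball m" "0 < d z"
    using out[of z] nonneg[of z] \<open>z \<in> SG\<close> by auto
  define M where "M = Max (d ` SG_ball m)"
  have "M \<in> d ` SG_ball m"
    unfolding M_def using z by (intro Max_in) (auto simp: finite_SG_ball)
  then obtain a where a: "a \<in> SG_ball m" "d a = M" by auto
  have M: "d y \<le> M" if "y \<in> SG_ball m" for y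
    unfolding M_def using that by (intro Max_ge) (auto simp: finite_SG_ball)
  have M0: "0 < M" using M[OF z(1)] z(2) by simp
  have le: "d y \<le> M" if "y \<in> SG" for y
    using M[of y] out[OF that] M0 by (cases "y \<in> SG_ball m") auto
  have step: "y \<in> SG \<and> d y = M" if x: "x \<in> SG \<and> d x = M" and e: "(x, y) \<in> SG_edges" for x y
  proof -
    have "x \<in> SG_ball m" using x M0 out[of x] by auto
    then have "4 * d x \<le> (\<Sum>y\<in>neighbours x. d y)" using sub[of x] by (simp add: laplacian_def)
    then have "(\<Sum>y\<in>neighbours x. M - d y) \<le> 0"
      using x card_neighbours[of x] by (simp add: sum_subtractf)
    moreover have nn: "0 \<le> M - d y" if "y \<in> neighbours x" for y
      using le[of y] SG_edges_bounds(2)[of x y] that by (simp add: neighbours_def)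
    ultimately have "(\<Sum>y\<in>neighbours x. M - d y) = 0" by (meson antisym sum_nonneg)
    moreover have "y \<in> neighbours x" using e by (simp add: neighbours_def)
    ultimately have "M - d y = 0"
      using sum_nonneg_eq_0_iff[OF finite_neighbours, of x "\<lambda>y. M - d y"] nn by blast
    then show ?thesis using SG_edges_bounds(2)[OF e] by simp
  qed
  obtain k where k: "m < 2 ^ k" using ex_power_greater by blast
  have c: "(2 ^ k, 0) \<in> SG" using corners_in_G_verts(1) unfolding SG_def SG_plus_def by blast
  have "a \<in> SG" using a by (auto simp: SG_ball_def)
  have spread: "x \<in> SG \<and> d x = M \<longleftrightarrow> (0, 0) \<in> SG \<and> d (0, 0) = M" if "x \<in> SG" for x
    by (rule connected_SG[where P = "\<lambda>x. x \<in> SG \<and> d x = M"]) (use step that in blast)+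
  have "d (2 ^ k, 0) = M" using spread[OF \<open>a \<in> SG\<close>] spread[OF c] a \<open>a \<in> SG\<close> c by simp
  moreover have "(2 ^ k, 0) \<notin> SG_ball m" using k by (simp add: SG_ball_def)
  ultimately show False using out[OF c] M0 by simp
qed

section \<open>Limits of divisible sandpiles\<close>

lemma odometer_after_Suc:
  "odometer_after h \<mu>0 s (Suc k) y
    = odometer_after h \<mu>0 s k y + emitted h (s k) (sand_after h \<mu>0 s k) * indicat_real {s k} y"
proof -
  have "{j. j < Suc k \<and> s j = y} = {j. j < k \<and> s j = y} \<union> (if s k = y then {k} else {})"
    by (auto simp: less_Suc_eq)
  then show ?thesis by (auto simp: odometer_after_def)
qed

lemma sand_after_eq: "sand_after h \<mu>0 s k z = \<mu>0 z + laplacian (odometer_after h \<mu>0 s k) z"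
proof (induction k)
  case 0
  show ?case by (simp add: odometer_after_def laplacian_def)
next
  case (Suc k)
  show ?case
    unfolding odometer_after_Suc[abs_def] laplacian_add_scaled using Suc
    by (simp add: topple_def)
qed

lemma not_neighbour_self: "x \<notin> neighbours x"
  using SG_edges_bounds(3)[of x x] by (auto simp: neighbours_def)

lemma laplacian_indicator_self: "laplacian (indicat_real {x}) x = -1"
proof -
  have "(\<Sum>y\<in>neighbours x. indicat_real {x} y) = 0"
    using not_neighbour_self by (intro sum.neutral) (auto simp: indicator_def)
  then show ?thesis by (simp add: laplacian_def)
qed

text \<open>Since no vertex is its own neighbour, toppling leaves exactly the height at an unstable vertex.\<close>

lemma topple_at: "topple h x \<mu> x = min (\<mu> x) (h x)"
  by (simp add: topple_def laplacian_indicator_self emitted_def)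

text \<open>Least action principle: a nonnegative stabilizing function bounds every odometer. In an effective
toppling of \<open>x\<close> the new odometer still lies below \<open>w\<close> at the neighbours of \<open>x\<close>, while its
Laplacian at \<open>x\<close> is at least that of \<open>w\<close>, because the toppled vertex ends up exactly at height
\<open>h x\<close>; solving the Laplacian for the value at \<open>x\<close> gives the bound there.\<close>

lemma least_action:
  assumes s: "range s \<subseteq> SG" and nonneg: "\<And>z. z \<in> SG \<Longrightarrow> 0 \<le> w z"
    and stable: "\<And>z. z \<in> SG \<Longrightarrow> \<mu>0 z + laplacian w z \<le> h z"
    and z: "z \<in> SG"
  shows "odometer_after h \<mu>0 s k z \<le> w z"
  using z
proof (induction k arbitrary: z)
  case 0
  then show ?case using nonneg by (simp add: odometer_after_def)
next
  case (Suc k)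
  let ?u = "odometer_after h \<mu>0 s" and ?\<mu> = "sand_after h \<mu>0 s"
  have le: "?u (Suc k) y \<le> w y" if "y \<in> SG" "y \<noteq> s k" for y
    using Suc.IH[OF that(1)] that(2) by (simp add: odometer_after_Suc)
  show ?case
  proof (cases "z = s k \<and> ?\<mu> k z > h z")
    case False
    then have "?u (Suc k) z = ?u k z"
      by (auto simp: odometer_after_Suc emitted_def)
    then show ?thesis using Suc by simp
  next
    case True
    then have "?\<mu> (Suc k) z = h z" by (auto simp: topple_at)
    then have "laplacian w z \<le> laplacian (?u (Suc k)) z"
      using stable[OF Suc.prems] by (simp add: sand_after_eq del: sand_after.simps)
    moreover have "?u (Suc k) y \<le> w y" if "y \<in> neighbours z" for y
      using le[of y] that True SG_edges_bounds(2,3)[of z y] by (auto simp: neighbours_def)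
    then have "(\<Sum>y\<in>neighbours z. ?u (Suc k) y) \<le> (\<Sum>y\<in>neighbours z. w y)"
      by (rule sum_mono)
    ultimately show ?thesis by (simp add: laplacian_def)
  qed
qed

lemma laplacian_tendsto:
  assumes "\<And>y. y \<in> SG \<Longrightarrow> (\<lambda>k. f k y) \<longlonglongrightarrow> g y" and "x \<in> SG"
  shows "(\<lambda>k. laplacian (f k) x) \<longlonglongrightarrow> laplacian g x"
  unfolding laplacian_def
proof (intro tendsto_intros assms)
  fix y assume "y \<in> neighbours x"
  then show "y \<in> SG" using SG_edges_bounds(2)[of x y] by (simp add: neighbours_def)
qed

text \<open>A candidate \<open>w\<close> that stabilizes the configuration, vanishes off a ball and fills the ball to the
height is the odometer. The odometers increase and are bounded by \<open>w\<close>, hence converge to some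
\<open>v \<le> w\<close>. Every vertex is toppled infinitely often and is at most at height right after each of
its topplings, so \<open>v\<close> is stabilizing as well. On the ball \<open>w\<close> produces the full height and \<open>v\<close> at
most that, so \<open>w - v\<close> is subharmonic there, and the maximum principle gives \<open>v = w\<close>.\<close>

lemma sandpile_limits:
  assumes s: "toppling_sequence s"
    and nonneg: "\<And>z. z \<in> SG \<Longrightarrow> 0 \<le> w z"
    and out: "\<And>z. z \<in> SG \<Longrightarrow> z \<notin> SG_ball m \<Longrightarrow> w z = 0"
    and stable: "\<And>z. z \<in> SG \<Longrightarrow> \<mu>0 z + laplacian w z \<le> h z"
    and full: "\<And>z. z \<in> SG_ball m \<Longrightarrow> \<mu>0 z + laplacian w z = h z"
    and z: "z \<in> SG"
  shows "(\<lambda>k. odometer_after h \<mu>0 s k z) \<longlonglongrightarrow> w z"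
    and "(\<lambda>k. sand_after h \<mu>0 s k z) \<longlonglongrightarrow> \<mu>0 z + laplacian w z"
proof -
  let ?u = "odometer_after h \<mu>0 s" and ?\<mu> = "sand_after h \<mu>0 s"
  have s': "range s \<subseteq> SG" and inf: "\<And>x. x \<in> SG \<Longrightarrow> infinite {k. s k = x}"
    using s by (auto simp: toppling_sequence_def)
  have le: "?u k y \<le> w y" if "y \<in> SG" for k y
    by (rule least_action[OF s']) (use nonneg stable that in blast)+
  have inc: "incseq (\<lambda>k. ?u k y)" for y
    by (rule incseq_SucI) (simp add: odometer_after_Suc emitted_def indicator_def)
  have "\<exists>v. \<forall>y\<in>SG. (\<lambda>k. ?u k y) \<longlonglongrightarrow> v y"
  proof (intro bchoice ballI)
    fix y assume "y \<in> SG"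
    with le have "\<forall>k. ?u k y \<le> w y" by simp
    then show "\<exists>l. (\<lambda>k. ?u k y) \<longlonglongrightarrow> l"
      by (rule incseq_convergent[OF inc]) (rule exI)
  qed
  then obtain v where v: "\<And>y. y \<in> SG \<Longrightarrow> (\<lambda>k. ?u k y) \<longlonglongrightarrow> v y" by blast
  have \<mu>: "(\<lambda>k. ?\<mu> k y) \<longlonglongrightarrow> \<mu>0 y + laplacian v y" if "y \<in> SG" for y
    unfolding sand_after_eq by (intro tendsto_intros laplacian_tendsto v that)
  have v_stable: "\<mu>0 y + laplacian v y \<le> h y" if y: "y \<in> SG" for y
  proof (rule ccontr)
    assume "\<not> ?thesis"
    then have "\<forall>\<^sub>F k in sequentially. h y < ?\<mu> k y"
      using \<mu>[OF y] by (intro order_tendstoD(1)) auto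
    then obtain N where N: "\<And>k. N \<le> k \<Longrightarrow> h y < ?\<mu> k y" by (auto simp: eventually_sequentially)
    obtain k where "N < k" "s k = y"
      using inf[OF y] by (auto simp: infinite_nat_iff_unbounded)
    then have "?\<mu> (Suc k) y \<le> h y" by (auto simp: topple_at)
    then show False using N[of "Suc k"] \<open>N < k\<close> by simp
  qed
  have vw: "v y \<le> w y" if "y \<in> SG" for y
    using v[OF that] le[OF that] by (intro LIMSEQ_le_const2) auto
  have v0: "0 \<le> v y" if "y \<in> SG" for y
    using incseq_le[OF inc v[OF that], of 0] by (simp add: odometer_after_def)
  have "w y - v y = 0" if y: "y \<in> SG" for y
  proof (rule maximum_principle[where m = m])
    show "0 \<le> w z - v z" if "z \<in> SG" for z using vw[OF that] by simp
    show "w z - v z = 0" if "z \<in> SG" "z \<notin> SG_ball m" for z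
      using out[OF that] vw[OF that(1)] v0[OF that(1)] by simp
    show "0 \<le> laplacian (\<lambda>z. w z - v z) z" if "z \<in> SG_ball m" for z
      using full[OF that] v_stable[of z] that laplacian_add_scaled[of w "-1" v z]
      by (auto simp: SG_ball_def)
  qed (rule y)
  then have eq: "v y = w y" if "y \<in> SG" for y using that by simp
  show "(\<lambda>k. ?u k z) \<longlonglongrightarrow> w z" using v[OF z] eq[OF z] by simp
  have "(\<lambda>k. ?u k y) \<longlonglongrightarrow> w y" if "y \<in> SG" for y using v[OF that] eq[OF that] by simp
  then show "(\<lambda>k. ?\<mu> k z) \<longlonglongrightarrow> \<mu>0 z + laplacian w z"
    unfolding sand_after_eq by (intro tendsto_intros laplacian_tendsto z)
qed

theorem theorem4p2:
  fixes n :: int and s :: "nat \<Rightarrow> point"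
  assumes "toppling_sequence s"
  shows "let h = (\<lambda>_. 1); \<mu>0 = (\<lambda>z. ball_mass n * indicat_real {(0, 0)} z) in
    (\<forall>z\<in>SG. convergent (\<lambda>k. sand_after h \<mu>0 s k z) \<and>
             convergent (\<lambda>k. odometer_after h \<mu>0 s k z)) \<and>
    (\<forall>z\<in>SG. limit_sand h \<mu>0 s z =
       (if z \<in> SG_ball n - inner_boundary (SG_ball n) then 1
        else if z \<in> inner_boundary (SG_ball n) then 1 / 2
        else 0)) \<and>
    sandpile_cluster h \<mu>0 s = SG_ball (n - 1)"
proof -
  define h :: "point \<Rightarrow> real" where "h = (\<lambda>_. 1)"
  define \<mu>0 :: "point \<Rightarrow> real" where "\<mu>0 = (\<lambda>z. ball_mass n * indicat_real {(0, 0)} z)"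
  obtain w where pos: "\<And>z. z \<in> SG_ball (n - 1) \<Longrightarrow> 0 < w z"
    and out: "\<And>z. z \<in> SG \<Longrightarrow> z \<notin> SG_ball (n - 1) \<Longrightarrow> w z = 0"
    and lap: "\<And>z. z \<in> SG \<Longrightarrow> \<mu>0 z + laplacian w z = ball_density n z"
    using ball_odometer[of n] unfolding \<mu>0_def by metis
  have nonneg: "0 \<le> w z" if "z \<in> SG" for z
    using pos[of z] out[OF that] by (cases "z \<in> SG_ball (n - 1)") auto
  have stable: "\<mu>0 z + laplacian w z \<le> h z" if "z \<in> SG" for z
    unfolding lap[OF that] by (simp add: ball_density_def h_def)
  have full: "\<mu>0 z + laplacian w z = h z" if z: "z \<in> SG_ball (n - 1)" for z
  proof -
    have "y \<in> SG_ball n" if "(z, y) \<in> SG_edges" for y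
      using SG_edges_bounds(2,7)[OF that] z by (auto simp: SG_ball_def)
    then have "z \<in> SG_ball n - inner_boundary (SG_ball n)"
      using z by (auto simp: inner_boundary_def SG_ball_def)
    moreover have "z \<in> SG" using z by (auto simp: SG_ball_def)
    ultimately show ?thesis by (simp add: lap ball_density_def h_def)
  qed
  have lim: "(\<lambda>k. odometer_after h \<mu>0 s k z) \<longlonglongrightarrow> w z"
    "(\<lambda>k. sand_after h \<mu>0 s k z) \<longlonglongrightarrow> \<mu>0 z + laplacian w z" if "z \<in> SG" for z
    by (rule sandpile_limits[OF assms, where m = "n - 1"]; use nonneg out stable full that in blast)+
  have "convergent (\<lambda>k. sand_after h \<mu>0 s k z)" "convergent (\<lambda>k. odometer_after h \<mu>0 s k z)"
    "limit_sand h \<mu>0 s z = ball_density n z" "odometer h \<mu>0 s z = w z" if "z \<in> SG" for z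
    using lim[OF that] lap[OF that]
    by (auto simp: convergent_def limit_sand_def odometer_def intro: limI)
  note limits = this
  have "z \<in> sandpile_cluster h \<mu>0 s \<longleftrightarrow> z \<in> SG_ball (n - 1)" for z
  proof (cases "z \<in> SG")
    case True
    then show ?thesis
      using limits(4)[OF True] pos[of z] out[OF True]
      by (cases "z \<in> SG_ball (n - 1)") (simp_all add: sandpile_cluster_def)
  next
    case False
    then show ?thesis by (auto simp: sandpile_cluster_def SG_ball_def)
  qed
  then have "sandpile_cluster h \<mu>0 s = SG_ball (n - 1)" by blast
  with limits show ?thesis
    unfolding Let_def h_def[symmetric] \<mu>0_def[symmetric] ball_density_def by blast
qed

end
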